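(* Let $q\in\mathbb{C}$ with $|q|<1$. Then $$\sum_{n=0}^{\infty}\frac{q^{(n^2+3n)/2}(-q;q)_{n}}{(q;q^2)_{n+1}(q;q)_{n+1}} =\frac{(q^{10};q^{10})_{\infty}}{(q;q)_{\infty}(q;q^2)_{\infty}(-q^3,-q^4,-q^6,-q^7;q^{10})_{\infty}}.$$
   Context: For $|q|<1$, $x\in\mathbb{C}$ and an integer $n\ge 0$: $(x;q)_n=\prod_{j=0}^{n-1}(1-xq^j)$ (so $(x;q)_0=1$), $(x;q)_\infty=\prod_{j=0}^{\infty}(1-xq^j)$, and $(x_1,\dots,x_k;q)_\infty=\prod_{i=1}^k (x_i;q)_\infty$. The same notation is used with base $q^m$ in place of $q$. *)

theory Defs
  imports "HOL-Analysis.Analysis"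
begin

definition qpoch :: "complex \<Rightarrow> complex \<Rightarrow> nat \<Rightarrow> complex"
  where "qpoch x q n = (\<Prod>j<n. 1 - x * q ^ j)"

definition qpoch_inf :: "complex \<Rightarrow> complex \<Rightarrow> complex"
  where "qpoch_inf x q = (\<Prod>j. 1 - x * q ^ j)"

definition qpoch_inf_list :: "complex list \<Rightarrow> complex \<Rightarrow> complex"
  where "qpoch_inf_list xs q = (\<Prod>x\<leftarrow>xs. qpoch_inf x q)"

text \<open>
  The infinite product is a genuine one whenever \<open>norm q < 1\<close>, including the case
  where finitely many factors vanish.
\<close>

lemma qpoch_inf_has_prod:
  assumes "norm q < 1"
  shows "(\<lambda>j. 1 - x * q ^ j) has_prod qpoch_inf x q"
proof -
  have "summable (\<lambda>j. norm x * norm q ^ j)"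
    using assms by (intro summable_mult summable_geometric) simp
  then have "abs_convergent_prod (\<lambda>j. 1 - x * q ^ j)"
    by (simp add: abs_convergent_prod_conv_summable norm_mult norm_power)
  then show ?thesis
    unfolding qpoch_inf_def
    by (intro convergent_prod_has_prod abs_convergent_prod_imp_convergent_prod)
qed

end

theory Submission
  imports Defs
begin

text \<open>
  Since \<open>2 (-q;q)\<^sub>n = (-1;q)\<^sub>n\<^sub>+\<^sub>1\<close>, a shift of the index turns the left-hand side \<open>L\<close> into
  \<open>1 + 2qL = S\<close> with \<open>S = (\<Sum>n. (-1;q)\<^sub>n q\<^bsup>n(n+1)/2\<^esup> / ((q;q\<^sup>2)\<^sub>n (q;q)\<^sub>n))\<close>. Bailey's lemma with \<open>a = 1\<close>,
  applied to the pair with \<open>\<beta>\<^sub>n = 1 / ((q;q\<^sup>2)\<^sub>n (q;q)\<^sub>n)\<close>, gives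
  \<open>S = (-q;q)\<^sub>\<infinity> / (q;q)\<^sub>\<infinity> * (\<Sum>r\<in>\<int>. (-1)\<^sup>r q\<^bsup>5r\<^sup>2\<^esup>)\<close>. With \<open>J(x) = (\<Sum>k\<in>\<int>. x\<^sup>k q\<^bsup>5k(k-1)\<^esup>)\<close> and the Jacobi
  triple product, the evaluation of \<open>S - 1\<close> as an infinite product is equivalent to the three-term relation
  \<open>J(q) J(q\<^sup>2) J(q\<^sup>3) J(q\<^sup>4) - J(-q) J(-q\<^sup>2) J(-q\<^sup>3) J(-q\<^sup>4) = q J(1) J(q\<^sup>5) J(q) J(q\<^sup>2)\<close>. To obtain it,
  each product of two values of \<open>J\<close> is split according to the parity of the sum of the two indices,
  which writes all of them in terms of five theta functions of base \<open>q\<^bsup>20\<^esup>\<close>.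
\<close>

section \<open>q-Pochhammer symbols and interchange of limits\<close>

lemma qpoch_0 [simp]: "qpoch x q 0 = 1"
  and qpoch_Suc [simp]: "qpoch x q (Suc n) = qpoch x q n * (1 - x * q ^ n)"
  by (simp_all add: qpoch_def)

lemma qpoch_add: "qpoch x q (m + n) = qpoch x q m * qpoch (x * q ^ m) q n"
  by (induction n) (simp_all add: power_add mult_ac)

lemma qpoch_Suc_shift: "qpoch x q (Suc n) = (1 - x) * qpoch (x * q) q n"
  using qpoch_add[of x q 1 n] by simp

lemma qpoch_tendsto:
  assumes "norm q < 1"
  shows "qpoch x q \<longlonglongrightarrow> qpoch_inf x q"
  using has_prod_imp_tendsto'[OF qpoch_inf_has_prod[OF assms, of x]]
  by (simp add: qpoch_def[abs_def])

lemma qpoch_inf_split: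
  assumes "norm q < 1"
  shows "qpoch_inf x q = qpoch x q m * qpoch_inf (x * q ^ m) q"
proof (rule LIMSEQ_unique)
  show "(\<lambda>n. qpoch x q (m + n)) \<longlonglongrightarrow> qpoch_inf x q"
    using LIMSEQ_ignore_initial_segment[OF qpoch_tendsto[OF assms, of x], of m] by (simp add: add.commute)
  show "(\<lambda>n. qpoch x q (m + n)) \<longlonglongrightarrow> qpoch x q m * qpoch_inf (x * q ^ m) q"
    unfolding qpoch_add by (intro tendsto_intros qpoch_tendsto assms)
qed

lemma one_minus_geometric_nonzero:
  fixes x q :: complex
  assumes "norm q < 1" "norm x < 1"
  shows "1 - x * q ^ n \<noteq> 0"
proof -
  have "norm (x * q ^ n) \<le> norm x * 1"
    unfolding norm_mult norm_power using assms by (intro mult_left_mono power_le_one) auto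
  then show ?thesis using assms(2) by auto
qed

lemma qpoch_nonzero:
  assumes "norm q < 1" "norm x < 1"
  shows "qpoch x q n \<noteq> 0"
  using one_minus_geometric_nonzero[OF assms] by (auto simp: qpoch_def)

lemma qpoch_inf_nonzero:
  assumes "norm q < 1" "norm x < 1"
  shows "qpoch_inf x q \<noteq> 0"
  unfolding qpoch_inf_def
  using qpoch_inf_has_prod[OF assms(1)] one_minus_geometric_nonzero[OF assms]
  by (intro prodinf_nonzero) (auto simp: has_prod_iff)

lemma qpoch_bounded:
  assumes "norm q < 1"
  obtains C where "C > 0" "\<And>n. norm (qpoch x q n) \<le> C"
  using convergent_imp_Bseq[OF convergentI[OF qpoch_tendsto[OF assms, of x]]]
  by (auto simp: Bseq_def)

lemma inverse_qpoch_bounded: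
  assumes "norm q < 1" "norm x < 1"
  obtains C where "C > 0" "\<And>n. norm (inverse (qpoch x q n)) \<le> C"
proof -
  have "(\<lambda>n. inverse (qpoch x q n)) \<longlonglongrightarrow> inverse (qpoch_inf x q)"
    by (intro tendsto_inverse qpoch_tendsto qpoch_inf_nonzero assms)
  from convergent_imp_Bseq[OF convergentI[OF this]] show ?thesis
    using that by (auto simp: Bseq_def)
qed

section \<open>Factorisation by residue classes of the exponent, and Euler's odd-distinct
  theorem\<close>

lemma qpoch_dissect: "qpoch x q (m * n) = (\<Prod>i<m. qpoch (x * q ^ i) (q ^ m) n)"
proof (induction n)
  case (Suc n)
  have "qpoch x q (m * Suc n) = qpoch x q (m * n) * qpoch (x * q ^ (m * n)) q m"
    using qpoch_add[of x q "m * n" m] by (simp add: add.commute)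
  then show ?case
    by (simp add: Suc prod.distrib qpoch_def[of _ _ m] power_mult mult_ac)
qed simp

lemma qpoch_inf_dissect:
  assumes "norm q < 1" "m > 0"
  shows "qpoch_inf x q = (\<Prod>i<m. qpoch_inf (x * q ^ i) (q ^ m))"
proof (rule LIMSEQ_unique)
  have "strict_mono (\<lambda>n. m * n)"
    using assms(2) by (auto simp: strict_mono_def)
  from LIMSEQ_subseq_LIMSEQ[OF qpoch_tendsto[OF assms(1)] this]
  show "(\<lambda>n. qpoch x q (m * n)) \<longlonglongrightarrow> qpoch_inf x q"
    by (simp add: o_def)
  have "norm (q ^ m) < 1"
    using assms power_less_one_iff[of "norm q" m] by (simp add: norm_power)
  then show "(\<lambda>n. qpoch x q (m * n)) \<longlonglongrightarrow> (\<Prod>i<m. qpoch_inf (x * q ^ i) (q ^ m))"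
    unfolding qpoch_dissect by (intro tendsto_prod qpoch_tendsto)
qed

lemma qpoch_mult_minus: "qpoch x q n * qpoch (- x) q n = qpoch (x\<^sup>2) (q\<^sup>2) n"
  by (induction n) (simp_all add: algebra_simps power2_eq_square power_mult_distrib)

lemma norm_power_less_1:
  fixes q :: complex
  assumes "norm q < 1" "n > 0"
  shows "norm (q ^ n) < 1"
  using assms power_less_one_iff[of "norm q" n] by (simp add: norm_power)

lemma qpoch_inf_mult_minus:
  assumes "norm q < 1"
  shows "qpoch_inf x q * qpoch_inf (- x) q = qpoch_inf (x\<^sup>2) (q\<^sup>2)"
proof (rule LIMSEQ_unique)
  show "(\<lambda>n. qpoch x q n * qpoch (- x) q n) \<longlonglongrightarrow> qpoch_inf x q * qpoch_inf (- x) q"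
    by (intro tendsto_mult qpoch_tendsto assms)
  show "(\<lambda>n. qpoch x q n * qpoch (- x) q n) \<longlonglongrightarrow> qpoch_inf (x\<^sup>2) (q\<^sup>2)"
    unfolding qpoch_mult_minus by (intro qpoch_tendsto norm_power_less_1 assms) simp
qed

text \<open>Splitting \<open>qpoch_inf q q\<close> by parity and multiplying by
  \<open>qpoch_inf (- q) q\<close> leaves \<open>qpoch_inf (q^2) (q^2)\<close> on both sides, where
  it cancels.\<close>

lemma euler_odd_distinct:
  assumes "norm q < 1"
  shows "qpoch_inf q (q\<^sup>2) * qpoch_inf (- q) q = 1"
proof -
  have "qpoch_inf q q = qpoch_inf q (q\<^sup>2) * qpoch_inf (q\<^sup>2) (q\<^sup>2)"
    using qpoch_inf_dissect[OF assms, of 2 q] by (simp add: eval_nat_numeral)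
  moreover have "qpoch_inf (q\<^sup>2) (q\<^sup>2) \<noteq> 0"
    using assms by (intro qpoch_inf_nonzero norm_power_less_1) auto
  ultimately show ?thesis
    using qpoch_inf_mult_minus[OF assms, of q] by (simp add: mult_ac)
qed

section \<open>Limits of infinite sums, and products of infinite sums\<close>

lemma tannery_nat:
  fixes a :: "nat \<Rightarrow> nat \<Rightarrow> complex"
  assumes "\<And>k. (\<lambda>n. a k n) \<longlonglongrightarrow> b k" "\<And>k n. norm (a k n) \<le> M k" "summable M"
  shows "(\<lambda>n. \<Sum>k. a k n) \<longlonglongrightarrow> (\<Sum>k. b k)"
proof -
  have "\<forall>\<^sub>F (k, n) in sequentially \<times>\<^sub>F sequentially. norm (a k n) \<le> M k"
    using assms(2) by (intro always_eventually) auto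
  from tannerys_theorem[OF assms(1) this assms(3)] show ?thesis by simp
qed

lemma infsum_nat_eq_suminf:
  fixes f :: "nat \<Rightarrow> complex"
  assumes "f summable_on UNIV"
  shows "infsum f UNIV = suminf f"
  using has_sum_imp_sums[OF has_sum_infsum[OF assms]] by (rule sums_unique)

text \<open>The enumeration \<open>int_decode\<close> reduces this to \<open>tannery_nat\<close>;
  the majorant makes every sum involved absolutely convergent, so that \<open>infsum\<close> and
  \<open>suminf\<close> agree.\<close>

lemma tannery_int:
  fixes a :: "int \<Rightarrow> nat \<Rightarrow> complex"
  assumes lim: "\<And>k. (\<lambda>n. a k n) \<longlonglongrightarrow> b k" and le: "\<And>k n. norm (a k n) \<le> M k"
    and M: "M summable_on UNIV"
  shows "(\<lambda>n. \<Sum>\<^sub>\<infinity>k. a k n) \<longlonglongrightarrow> (\<Sum>\<^sub>\<infinity>k. b k)"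
proof -
  have le_b: "norm (b k) \<le> M k" for k
    by (rule LIMSEQ_le_const2[OF tendsto_norm[OF lim]]) (use le in auto)
  have sums: "f summable_on UNIV" if "\<And>k. norm (f k) \<le> M k" for f :: "int \<Rightarrow> complex"
    using Infinite_Sum.abs_summable_on_comparison_test'[OF M, of f] that abs_summable_summable by blast
  have eq: "infsum f UNIV = (\<Sum>i. f (int_decode i))" if "\<And>k. norm (f k) \<le> M k" for f :: "int \<Rightarrow> complex"
    using infsum_nat_eq_suminf[of "\<lambda>i. f (int_decode i)"] sums[OF that]
    by (simp add: summable_on_reindex_bij_betw[OF bij_int_decode] infsum_reindex_bij_betw[OF bij_int_decode])
  have "summable (\<lambda>i. M (int_decode i))"
    by (rule summable_on_imp_summable) (simp add: summable_on_reindex_bij_betw[OF bij_int_decode] M)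
  then have "(\<lambda>n. \<Sum>i. a (int_decode i) n) \<longlonglongrightarrow> (\<Sum>i. b (int_decode i))"
    by (rule tannery_nat[rotated 2]) (rule lim le)+
  then show ?thesis
    by (simp add: eq[OF le] eq[OF le_b])
qed

lemma infsum_mult_Times:
  fixes f :: "'a \<Rightarrow> complex" and g :: "'b \<Rightarrow> complex"
  assumes "f summable_on A" "g summable_on B"
  shows "(\<lambda>(x, y). f x * g y) summable_on (A \<times> B)"
    and "(\<Sum>\<^sub>\<infinity>(x, y)\<in>A \<times> B. f x * g y) = infsum f A * infsum g B"
proof -
  have 1: "(\<lambda>x. norm (f x)) summable_on A" and 2: "(\<lambda>x. norm (g x)) summable_on B"
    using assms by (simp_all flip: summable_on_iff_abs_summable_on_complex)
  have "(\<lambda>z. norm ((\<lambda>(x, y). f x * g y) z)) summable_on (A \<times> B)"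
    unfolding Infinite_Sum.abs_summable_on_Sigma_iff using 1 2
    by (auto simp: norm_mult infsum_cmult_right' infsum_nonneg abs_mult
             intro!: summable_on_cmult_right summable_on_cmult_left)
  then show *: "(\<lambda>(x, y). f x * g y) summable_on (A \<times> B)"
    by (rule abs_summable_summable)
  show "(\<Sum>\<^sub>\<infinity>(x, y)\<in>A \<times> B. f x * g y) = infsum f A * infsum g B"
    using infsum_Sigma_banach[OF *] by (simp add: infsum_cmult_right' infsum_cmult_left')
qed


section \<open>A limiting case of the q-Gauss sum\<close>

lemma triangular_Suc: "Suc k * k div 2 = k + k * (k - 1) div (2::nat)"
proof (cases k)
  case (Suc m)
  have "Suc (Suc m) * Suc m = Suc m * m + Suc m * 2"
    by (simp add: algebra_simps)
  then show ?thesis using Suc by (metis div_mult_self2 add.commute diff_Suc_1 mult.commute zero_neq_numeral)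
qed simp

text \<open>The ratio of consecutive terms, \<open>norm x * norm q ^ k\<close>, tends to 0 whatever
  \<open>x\<close> is.\<close>

lemma summable_norm_triangular:
  fixes q x :: complex
  assumes "norm q < 1"
  shows "summable (\<lambda>k. norm (x ^ k * q ^ (k * (k - 1) div 2)))"
proof -
  have "(\<lambda>k. norm x * norm q ^ k) \<longlonglongrightarrow> norm x * 0"
    using assms by (intro tendsto_intros LIMSEQ_power_zero) auto
  then have "eventually (\<lambda>k. norm x * norm q ^ k < 1/2) sequentially"
    by (rule order_tendstoD(2)) simp
  then obtain N where N: "\<And>k. k \<ge> N \<Longrightarrow> norm x * norm q ^ k < 1/2"
    by (auto simp: eventually_sequentially)
  show ?thesis
  proof (rule summable_ratio_test[of "1/2" N])
    fix k assume "k \<ge> N"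
    have "norm (x ^ Suc k * q ^ (Suc k * (Suc k - 1) div 2))
        = (norm x * norm q ^ k) * norm (x ^ k * q ^ (k * (k - 1) div 2))"
      using triangular_Suc[of k]
      by (simp add: power_add norm_mult norm_power mult_ac del: mult_Suc mult_Suc_right)
    also have "\<dots> \<le> 1/2 * norm (x ^ k * q ^ (k * (k - 1) div 2))"
      using N[OF \<open>k \<ge> N\<close>] by (intro mult_right_mono) auto
    finally show "norm (norm (x ^ Suc k * q ^ (Suc k * (Suc k - 1) div 2)))
        \<le> 1/2 * norm (norm (x ^ k * q ^ (k * (k - 1) div 2)))" by simp
  qed simp
qed

text \<open>
  The summand of \<open>\<^sub>2\<phi>\<^sub>1(a, b; c; c/(ab))\<close> in the limit \<open>a \<rightarrow> \<infinity>\<close>, with \<open>d = -c/b\<close>. Multiplying \<open>(b;q)\<^sub>k\<close> by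
  \<open>d\<^sup>k\<close> gives a product that needs no division by \<open>b\<close> and is regular at \<open>c = d = 0\<close>.
\<close>

definition gauss_term :: "complex \<Rightarrow> complex \<Rightarrow> complex \<Rightarrow> nat \<Rightarrow> complex" where
  "gauss_term q c d k =
     (\<Prod>j<k. d + c * q ^ j) * q ^ (k * (k - 1) div 2) / (qpoch q q k * qpoch c q k)"

lemma gauss_term_0 [simp]: "gauss_term q c d 0 = 1"
  by (simp add: gauss_term_def)

text \<open>Majorant for Tannery's theorem in \<open>q_gauss_limit\<close>; the point is that it
  does not depend on \<open>n\<close>.\<close>

lemma gauss_term_uniform_bound:
  assumes q: "norm q < 1" and c: "norm c < 1"
  obtains M where "summable M"
    "\<And>k n. norm (gauss_term q (c * q ^ n) (d * q ^ n) k) \<le> M k"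
proof -
  obtain C1 where C1: "C1 > 0" "\<And>n. norm (inverse (qpoch q q n)) \<le> C1"
    using inverse_qpoch_bounded[OF q q] by metis
  obtain C2 where C2: "C2 > 0" "\<And>n. norm (inverse (qpoch c q n)) \<le> C2"
    using inverse_qpoch_bounded[OF q c] by metis
  obtain C3 where C3: "C3 > 0" "\<And>n. norm (qpoch c q n) \<le> C3"
    using qpoch_bounded[OF q] by metis
  \<comment> \<open>Each factor of the numerator has norm at most \<open>norm d + norm c\<close>,
    uniformly in \<open>n\<close>, so the \<open>k\<close>-th power dominates the product.\<close>
  define x where "x = complex_of_real (norm d + norm c)"
  define M where "M k = C1 * (C2 * C3) * norm (x ^ k * q ^ (k * (k - 1) div 2))" for k
  have "summable M"
    unfolding M_def by (intro summable_mult summable_norm_triangular q)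
  moreover have "norm (gauss_term q (c * q ^ n) (d * q ^ n) k) \<le> M k" for k n
  proof -
    have le1: "norm q ^ j \<le> 1" for j
      using q by (intro power_le_one) auto
    have "norm (d * q ^ n + c * q ^ n * q ^ j) \<le> norm d + norm c" for j
    proof -
      have "norm (d * q ^ n + c * q ^ n * q ^ j) \<le> norm d * norm q ^ n + norm c * norm q ^ (n + j)"
        by (rule order.trans[OF norm_triangle_ineq]) (simp add: norm_mult norm_power power_add)
      also have "\<dots> \<le> norm d * 1 + norm c * 1"
        using le1 by (intro add_mono mult_left_mono) auto
      finally show ?thesis by simp
    qed
    then have "(\<Prod>j<k. norm (d * q ^ n + c * q ^ n * q ^ j)) \<le> (\<Prod>j<k. norm d + norm c)"
      by (intro prod_mono) auto
    then have P: "norm (\<Prod>j<k. d * q ^ n + c * q ^ n * q ^ j) \<le> norm (x ^ k)"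
      by (simp add: prod_norm x_def norm_power del: of_real_add)
    \<comment> \<open>The shifted symbol is a quotient of two symbols starting at \<open>c\<close>,
      whose bounds do not involve \<open>n\<close>.\<close>
    have "inverse (qpoch (c * q ^ n) q k) = inverse (qpoch c q (n + k)) * qpoch c q n"
      using qpoch_nonzero[OF q c, of n] by (simp add: qpoch_add)
    then have I: "norm (inverse (qpoch (c * q ^ n) q k)) \<le> C2 * C3"
      using C2(1) C3(1) by (simp add: norm_mult mult_mono C2(2) C3(2))
    have "norm (gauss_term q (c * q ^ n) (d * q ^ n) k)
        = norm (inverse (qpoch q q k)) * norm (inverse (qpoch (c * q ^ n) q k)) *
          (norm (\<Prod>j<k. d * q ^ n + c * q ^ n * q ^ j) * norm (q ^ (k * (k - 1) div 2)))"
      by (simp add: gauss_term_def norm_mult norm_divide norm_inverse divide_inverse mult_ac)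
    also have "\<dots> \<le> C1 * (C2 * C3) * (norm (x ^ k) * norm (q ^ (k * (k - 1) div 2)))"
      using C1 C2 C3 by (intro mult_mono C1 I P mult_nonneg_nonneg order.refl) auto
    finally show ?thesis by (simp add: M_def norm_mult)
  qed
  ultimately show ?thesis by (rule that)
qed

lemma summable_gauss_term:
  assumes "norm q < 1" "norm c < 1"
  shows "summable (\<lambda>k. norm (gauss_term q c d k))"
proof -
  obtain M where "summable M" "\<And>k n. norm (gauss_term q (c * q ^ n) (d * q ^ n) k) \<le> M k"
    using gauss_term_uniform_bound[OF assms] by metis
  from summable_comparison_test'[OF this(1), of 0 "\<lambda>k. norm (gauss_term q c d k)"] this(2)[of 0]
  show ?thesis by simp
qed

text \<open>Contiguous relation in telescoping form, with certificate
  \<open>gauss_term q c d k * (1 - q ^ k)\<close>. The other two terms are rational multiples of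
  \<open>gauss_term q c d k\<close>, which leaves an identity of rational functions in
  \<open>q ^ k\<close>.\<close>

lemma gauss_term_telescope:
  assumes q: "norm q < 1" and c: "norm c < 1"
  shows "gauss_term q c d k - (1 + d) / (1 - c) * gauss_term q (c * q) (d * q) k
       = gauss_term q c d k * (1 - q ^ k) - gauss_term q c d (Suc k) * (1 - q ^ Suc k)"
proof -
  define T where "T = gauss_term q c d k"
  have nz: "1 - c \<noteq> 0" "1 - c * q ^ k \<noteq> 0" "1 - q * q ^ k \<noteq> 0" "qpoch q q k \<noteq> 0" "qpoch c q k \<noteq> 0"
    using one_minus_geometric_nonzero[OF q c, of 0] one_minus_geometric_nonzero[OF q c, of k]
      one_minus_geometric_nonzero[OF q q, of k] qpoch_nonzero[OF q] q c by auto
  have 1: "gauss_term q c d (Suc k) = T * ((d + c * q ^ k) * q ^ k / ((1 - q * q ^ k) * (1 - c * q ^ k)))"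
    using nz triangular_Suc[of k]
    by (simp add: T_def gauss_term_def power_add divide_simps mult_ac del: mult_Suc mult_Suc_right)
  have P: "(\<Prod>j<k. d * q + c * q * q ^ j) = q ^ k * (\<Prod>j<k. d + c * q ^ j)"
    by (induction k) (simp_all add: algebra_simps)
  have c': "qpoch (c * q) q k = qpoch c q k * (1 - c * q ^ k) / (1 - c)"
    using qpoch_Suc_shift[of c q k] nz by (simp add: field_simps)
  have 2: "gauss_term q (c * q) (d * q) k = T * (q ^ k * (1 - c) / (1 - c * q ^ k))"
    unfolding gauss_term_def P c' T_def using nz by (simp add: field_simps)
  have "1 - (1 + d) / (1 - c) * (q ^ k * (1 - c) / (1 - c * q ^ k))
      = (1 - q ^ k) - (d + c * q ^ k) * q ^ k / ((1 - q * q ^ k) * (1 - c * q ^ k)) * (1 - q ^ Suc k)"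
    using nz by (simp add: divide_simps) (simp add: algebra_simps)
  then have "T * (1 - (1 + d) / (1 - c) * (q ^ k * (1 - c) / (1 - c * q ^ k)))
      = T * ((1 - q ^ k) - (d + c * q ^ k) * q ^ k / ((1 - q * q ^ k) * (1 - c * q ^ k)) * (1 - q ^ Suc k))"
    by simp
  then show ?thesis
    unfolding 1 2 T_def[symmetric] by (simp only: right_diff_distrib mult.assoc mult_1_right mult.left_commute)
qed

lemma suminf_gauss_term_step:
  assumes q: "norm q < 1" and c: "norm c < 1"
  shows "(\<Sum>k. gauss_term q c d k) = (1 + d) / (1 - c) * (\<Sum>k. gauss_term q (c * q) (d * q) k)"
proof -
  have "norm (c * q) < 1"
    using mult_strict_mono'[OF c q] by (simp add: norm_mult)
  then have s: "summable (\<lambda>k. gauss_term q c d k)" "summable (\<lambda>k. gauss_term q (c * q) (d * q) k)"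
    using summable_gauss_term[OF q] c by (auto intro: summable_norm_cancel)
  \<comment> \<open>The certificate vanishes at \<open>k = 0\<close> and tends to 0, so the
    telescoping series has sum 0.\<close>
  have "(\<lambda>k. gauss_term q c d k * (1 - q ^ k)) \<longlonglongrightarrow> 0 * (1 - 0)"
    using q by (intro tendsto_intros LIMSEQ_power_zero summable_LIMSEQ_zero s)
  from telescope_sums'[OF this]
  have "(\<lambda>k. gauss_term q c d k - (1 + d) / (1 - c) * gauss_term q (c * q) (d * q) k) sums 0"
    unfolding gauss_term_telescope[OF assms] by simp
  moreover have "(\<lambda>k. gauss_term q c d k - (1 + d) / (1 - c) * gauss_term q (c * q) (d * q) k) sums
      ((\<Sum>k. gauss_term q c d k) - (1 + d) / (1 - c) * (\<Sum>k. gauss_term q (c * q) (d * q) k))"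
    by (intro sums_diff sums_mult summable_sums s)
  ultimately show ?thesis
    using sums_unique2 by fastforce
qed

text \<open>Iterating the contiguous relation moves \<open>c\<close> and \<open>d\<close> to 0 while
  the prefactors build up the two infinite products; at \<open>c = d = 0\<close> the series reduces
  to its first term.\<close>

lemma q_gauss_limit:
  assumes q: "norm q < 1" and c: "norm c < 1"
  shows "gauss_term q c d sums (qpoch_inf (- d) q / qpoch_inf c q)"
proof -
  define F where "F n = (\<Sum>k. gauss_term q (c * q ^ n) (d * q ^ n) k)" for n
  have cn: "norm (c * q ^ n) < 1" for n
  proof -
    have "norm c * norm q ^ n \<le> norm c * 1"
      using q by (intro mult_left_mono power_le_one) auto
    then show ?thesis using c by (simp add: norm_mult norm_power)
  qed
  have F: "F 0 = qpoch (- d) q n / qpoch c q n * F n" for n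
  proof (induction n)
    case (Suc n)
    have "F n = (1 + d * q ^ n) / (1 - c * q ^ n) * F (Suc n)"
      using suminf_gauss_term_step[OF q cn[of n], of "d * q ^ n"] by (simp add: F_def mult_ac)
    with Suc show ?case by simp
  qed simp
  obtain M where M: "summable M" "\<And>k n. norm (gauss_term q (c * q ^ n) (d * q ^ n) k) \<le> M k"
    using gauss_term_uniform_bound[OF assms] by metis
  have "(\<lambda>n. gauss_term q (c * q ^ n) (d * q ^ n) k) \<longlonglongrightarrow> gauss_term q 0 0 k" for k
  proof -
    have "(\<lambda>n. x * q ^ n) \<longlonglongrightarrow> x * 0" for x
      using q by (intro tendsto_intros LIMSEQ_power_zero)
    then have *: "(\<lambda>n. x * q ^ n) \<longlonglongrightarrow> 0" for x by simp
    show ?thesis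
      unfolding gauss_term_def qpoch_def[of _ _ k]
      by (intro tendsto_intros *) (use qpoch_nonzero[OF q q, of k] in \<open>simp add: qpoch_def\<close>)
  qed
  then have "F \<longlonglongrightarrow> (\<Sum>k. gauss_term q 0 0 k)"
    unfolding F_def[abs_def] by (rule tannery_nat[OF _ M(2) M(1)])
  also have "(\<Sum>k. gauss_term q 0 0 k) = (\<Sum>k\<in>{0}. gauss_term q 0 0 k)"
    by (rule suminf_finite) (auto simp: gauss_term_def)
  finally have "F \<longlonglongrightarrow> 1" by simp
  then have "(\<lambda>n. qpoch (- d) q n / qpoch c q n * F n) \<longlonglongrightarrow> qpoch_inf (- d) q / qpoch_inf c q * 1"
    by (intro tendsto_intros qpoch_tendsto q qpoch_inf_nonzero c)
  then have "F 0 = qpoch_inf (- d) q / qpoch_inf c q"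
    using LIMSEQ_unique[OF tendsto_const[of "F 0"]] unfolding F[symmetric] by simp
  moreover have "summable (gauss_term q c d)"
    using summable_gauss_term[OF assms] by (rule summable_norm_cancel)
  ultimately show ?thesis
    by (simp add: F_def sums_iff)
qed


section \<open>Gaussian binomial coefficients and the Jacobi triple product\<close>

text \<open>The value 0 outside the usual range lets Pascal's rules hold for every integer
  \<open>k\<close>, so that sums can run over all integers and be shifted freely.\<close>

definition qbin :: "complex \<Rightarrow> nat \<Rightarrow> int \<Rightarrow> complex" where
  "qbin q N k = (if 0 \<le> k \<and> k \<le> int N
     then qpoch q q N / (qpoch q q (nat k) * qpoch q q (nat (int N - k))) else 0)"

lemma qbin_sym: "qbin q N (int N - k) = qbin q N k"
  by (auto simp: qbin_def)

lemma qbin_Suc: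
  assumes q: "norm q < 1" "q \<noteq> 0"
  shows "qbin q (Suc N) k = qbin q N k + q powi (int N + 1 - k) * qbin q N (k - 1)"
proof -
  have nz [simp]: "qpoch q q n \<noteq> 0" "1 - q * q ^ n \<noteq> 0" for n
    using qpoch_nonzero[OF q(1) q(1)] one_minus_geometric_nonzero[OF q(1) q(1)] by auto
  consider "k < 0" | "k > int N + 1" | "k = 0" | "k = int N + 1" | "1 \<le> k" "k \<le> int N" by linarith
  then show ?thesis
  proof cases
    case 5
    define j m where "j = nat (k - 1)" and "m = nat (int N - k)"
    have k: "k = int (Suc j)" and N: "N = Suc j + m"
      using 5 by (auto simp: j_def m_def)
    have nats: "nat k = Suc j" "nat (int (Suc N) - k) = Suc m" "nat (1 + int N - k) = Suc m" "nat (int N - k) = m"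
      "nat (k - 1) = j" "nat (int N - (k - 1)) = Suc m" and pw: "int N + 1 - k = int (Suc m)"
      using k N by auto
    have "qbin q (Suc N) k
        = qpoch q q N / (qpoch q q j * qpoch q q m * (1 - q * q ^ j) * (1 - q * q ^ m)) * (1 - q * q ^ N)"
      using 5 nz by (simp add: qbin_def nats mult_ac)
    \<comment> \<open>Since \<open>N + 1 = (j + 1) + (m + 1)\<close>, the last factor splits into
      two parts, each of which cancels one factor of the denominator.\<close>
    also have "1 - q * q ^ N = (1 - q * q ^ m) + q ^ Suc m * (1 - q * q ^ j)"
      by (simp add: N power_add algebra_simps)
    also have "qpoch q q N / (qpoch q q j * qpoch q q m * (1 - q * q ^ j) * (1 - q * q ^ m)) * \<dots>
        = qbin q N k + q powi (int N + 1 - k) * qbin q N (k - 1)"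
      unfolding pw power_int_of_nat using 5 nz by (simp add: qbin_def nats divide_simps) (simp add: algebra_simps)
    finally show ?thesis .
  qed (auto simp: qbin_def nat_add_distrib simp del: qpoch_Suc)
qed

lemma qbin_Suc':
  assumes q: "norm q < 1" "q \<noteq> 0"
  shows "qbin q (Suc N) k = q powi k * qbin q N k + qbin q N (k - 1)"
proof -
  have "qbin q (Suc N) k = qbin q (Suc N) (int (Suc N) - k)"
    by (simp only: qbin_sym)
  also have "\<dots> = qbin q N (int N - (k - 1)) + q powi k * qbin q N (int N - k)"
    by (subst qbin_Suc[OF q]) (simp add: algebra_simps)
  finally show ?thesis by (simp only: qbin_sym add.commute)
qed

text \<open>Only finitely many indices meet the support of \<open>qbin\<close>; this settles all
  convergence in the finite identities.\<close>

lemma summable_qbin: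
  assumes "inj f"
  shows "(\<lambda>r::int. g r * qbin q N (f r)) summable_on UNIV"
proof (rule finite_nonzero_values_imp_summable_on)
  have "finite (f -` {0..int N})"
    using assms by (intro finite_vimageI) auto
  then show "finite {r \<in> UNIV. g r * qbin q N (f r) \<noteq> 0}"
    by (rule rev_finite_subset) (auto simp: qbin_def split: if_splits)
qed

lemma infsum_int_reflect: "(\<Sum>\<^sub>\<infinity>r. f (c - r)) = (\<Sum>\<^sub>\<infinity>r. f (r::int))"
  by (rule infsum_reindex_bij_betw, rule bij_betwI[of _ _ _ "\<lambda>r. c - r"]) auto

lemma infsum_int_shift: "(\<Sum>\<^sub>\<infinity>r. f (r + c)) = (\<Sum>\<^sub>\<infinity>r. f (r::int))"
  by (rule infsum_reindex_bij_betw, rule bij_betwI[of _ _ _ "\<lambda>r. r - c"]) auto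

text \<open>
  Slater's Bailey pair C(1) relative to \<open>a = 1\<close>: here \<open>slater_alpha q r\<close> and \<open>slater_alpha q (- r)\<close> together
  make up the term \<open>\<alpha>\<^sub>2\<^sub>r\<close>, and \<open>\<alpha>\<^sub>n = 0\<close> for odd \<open>n\<close>.
\<close>

definition slater_alpha :: "complex \<Rightarrow> int \<Rightarrow> complex" where
  "slater_alpha q r = (-1) powi r * q powi (3 * r\<^sup>2 - r)"

text \<open>Slater's pair before division by \<open>qpoch q q (2 * n)\<close>. Raising
  \<open>n\<close> by one takes two Pascal steps, which together contribute the factor
  \<open>1 + q ^ Suc n\<close>.\<close>

lemma infsum_qbin_slater:
  assumes q: "norm q < 1" "q \<noteq> 0"
  shows "(\<Sum>\<^sub>\<infinity>r. slater_alpha q r * qbin q (2 * n) (int n - 2 * r)) = qpoch (- q) q n"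
proof (induction n)
  case 0
  have "((\<lambda>r. slater_alpha q r * qbin q 0 (- 2 * r)) has_sum 1) UNIV"
    by (rule has_sum_finite_neutralI[of "{0}"]) (auto simp: qbin_def slater_alpha_def)
  then show ?case by (simp add: infsumI)
next
  case (Suc n)
  let ?a = "slater_alpha q"
  define X where "X = (\<Sum>\<^sub>\<infinity>r. ?a r * qbin q (2 * n + 1) (int n + 1 - 2 * r))"
  \<comment> \<open>Two Pascal steps: the first reduces to \<open>X\<close> by \<open>r \<mapsto> -r\<close>, while in the second the
    extra sum \<open>Y\<close> is antisymmetric under \<open>r \<mapsto> 1 - r\<close>.\<close>
  define Y where "Y = (\<Sum>\<^sub>\<infinity>r. (-1) powi r * q powi (3 * r\<^sup>2 - 3 * r) * qbin q (2 * n) (int n + 1 - 2 * r))"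
  have inj: "inj (\<lambda>r. c - 2 * r)" "inj (\<lambda>r. c + 2 * r)" for c :: int
    by (auto simp: inj_def)
  have "(\<Sum>\<^sub>\<infinity>r. ?a r * qbin q (2 * Suc n) (int (Suc n) - 2 * r))
      = (\<Sum>\<^sub>\<infinity>r. ?a r * qbin q (2 * n + 1) (int n + 1 - 2 * r)
          + q ^ Suc n * (?a (0 - r) * qbin q (2 * n + 1) (int n + 1 - 2 * (0 - r))))"
  proof (rule infsum_cong)
    fix r :: int
    \<comment> \<open>Symmetry of the Gaussian binomial turns the second Pascal term into
      \<open>q ^ Suc n\<close> times the first one at \<open>- r\<close>; the rest of the power of
      \<open>q\<close> goes into passing from \<open>slater_alpha q r\<close> to
      \<open>slater_alpha q (- r)\<close>.\<close>
    have "qbin q (2 * n + 1) (int n - 2 * r) = qbin q (2 * n + 1) (int n + 1 + 2 * r)"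
      using qbin_sym[of q "2 * n + 1" "int n + 1 + 2 * r"] by (simp add: algebra_simps)
    moreover have "?a r * q powi (int n + 1 + 2 * r) = q ^ Suc n * ?a (- r)"
    proof -
      have "q powi (3 * r\<^sup>2 - r) * q powi (int n + 1 + 2 * r) = q powi (int (Suc n) + (3 * r\<^sup>2 + r))"
        using q by (simp flip: power_int_add) (simp add: algebra_simps)
      also have "\<dots> = q ^ Suc n * q powi (3 * r\<^sup>2 + r)"
        using q by (simp only: power_int_add power_int_of_nat simp_thms)
      finally show ?thesis
        by (simp add: slater_alpha_def power_int_minus mult_ac flip: power_int_inverse)
    qed
    ultimately have "?a r * (q powi (int n + 1 + 2 * r) * qbin q (2 * n + 1) (int n - 2 * r))
        = q ^ Suc n * ?a (- r) * qbin q (2 * n + 1) (int n + 1 + 2 * r)"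
      by (simp only: mult.assoc[symmetric])
    then show "?a r * qbin q (2 * Suc n) (int (Suc n) - 2 * r)
      = ?a r * qbin q (2 * n + 1) (int n + 1 - 2 * r)
          + q ^ Suc n * (?a (0 - r) * qbin q (2 * n + 1) (int n + 1 - 2 * (0 - r)))"
      using qbin_Suc[OF q, of "2 * n + 1" "int n + 1 - 2 * r"] by (simp add: algebra_simps)
  qed
  also have "\<dots> = X + q ^ Suc n * X"
  proof -
    let ?f = "\<lambda>r. ?a r * qbin q (2 * n + 1) (int n + 1 - 2 * r)"
    have s: "?f summable_on UNIV" "(\<lambda>r. ?f (0 - r)) summable_on UNIV"
      using summable_qbin[OF inj(1), of ?a q "2 * n + 1" "int n + 1"]
        summable_qbin[OF inj(2), of "\<lambda>r. ?a (- r)" q "2 * n + 1" "int n + 1"] by simp_all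
    have "(\<Sum>\<^sub>\<infinity>r. ?f (0 - r)) = (\<Sum>\<^sub>\<infinity>r. ?f r)"
      by (rule infsum_int_reflect)
    then show ?thesis
      unfolding X_def using s
      by (simp only: infsum_add summable_on_cmult_right infsum_cmult_right')
  qed
  also have "X = (\<Sum>\<^sub>\<infinity>r. ?a r * qbin q (2 * n) (int n - 2 * r)) + q ^ Suc n * Y"
  proof -
    have "?a r * qbin q (2 * n + 1) (int n + 1 - 2 * r) = ?a r * qbin q (2 * n) (int n - 2 * r)
        + q ^ Suc n * ((-1) powi r * q powi (3 * r\<^sup>2 - 3 * r) * qbin q (2 * n) (int n + 1 - 2 * r))" for r
    proof -
      have "q powi (3 * r\<^sup>2 - r) * q powi (int n + 1 - 2 * r) = q powi (int (Suc n) + (3 * r\<^sup>2 - 3 * r))"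
        using q by (simp flip: power_int_add) (simp add: algebra_simps)
      also have "\<dots> = q ^ Suc n * q powi (3 * r\<^sup>2 - 3 * r)"
        using q by (simp only: power_int_add power_int_of_nat simp_thms)
      finally have "?a r * q powi (int n + 1 - 2 * r) = q ^ Suc n * ((-1) powi r * q powi (3 * r\<^sup>2 - 3 * r))"
        by (simp add: slater_alpha_def mult_ac)
      then show ?thesis
        using qbin_Suc'[OF q, of "2 * n" "int n + 1 - 2 * r"]
        by (simp add: distrib_left mult.assoc[symmetric] add.commute)
    qed
    then show ?thesis
      unfolding X_def Y_def
      using summable_qbin[OF inj(1)[of "int n"], of ?a q "2 * n"]
        summable_qbin[OF inj(1)[of "int n + 1"], of "\<lambda>r. (-1) powi r * q powi (3 * r\<^sup>2 - 3 * r)" q "2 * n"]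
      by (simp add: infsum_add summable_on_cmult_right infsum_cmult_right')
  qed
  also have "Y = 0"
  proof -
    have "(-1) powi (1 - r) * q powi (3 * (1 - r)\<^sup>2 - 3 * (1 - r)) * qbin q (2 * n) (int n + 1 - 2 * (1 - r))
       = - ((-1) powi r * q powi (3 * r\<^sup>2 - 3 * r) * qbin q (2 * n) (int n + 1 - 2 * r))" for r :: int
    proof -
      have "3 * (1 - r)\<^sup>2 - 3 * (1 - r) = 3 * r\<^sup>2 - 3 * r"
        by (simp add: power2_eq_square algebra_simps)
      moreover have "(-1 :: complex) powi (1 - r) = - ((-1) powi r)"
        using power_int_add[of "-1 :: complex" 1 "- r"]
        by (simp add: power_int_minus flip: power_int_inverse)
      moreover have "qbin q (2 * n) (int n + 1 - 2 * (1 - r)) = qbin q (2 * n) (int n + 1 - 2 * r)"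
        using qbin_sym[of q "2 * n" "int n + 1 - 2 * r"] by (simp add: algebra_simps)
      ultimately show ?thesis by (simp only: mult_minus_left)
    qed
    then have "Y = - Y"
      unfolding Y_def by (subst infsum_int_reflect[of _ 1, symmetric]) (simp only: infsum_uminus)
    then show ?thesis by simp
  qed
  finally show ?case using Suc by (simp add: algebra_simps)
qed

section \<open>The theta series and the Jacobi triple product\<close>

definition theta_term :: "complex \<Rightarrow> complex \<Rightarrow> int \<Rightarrow> complex" where
  "theta_term p x k = x powi k * p powi (k * (k - 1) div 2)"

definition theta :: "complex \<Rightarrow> complex \<Rightarrow> complex" where
  "theta p x = (\<Sum>\<^sub>\<infinity>k. theta_term p x k)"

lemma triangular_int_Suc: "(k + 1) * k div 2 = k + k * (k - 1) div (2 :: int)"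
proof -
  have "(k + 1) * k = k * (k - 1) + k * 2" by (simp add: algebra_simps)
  then show ?thesis by simp
qed

lemma theta_term_Suc:
  assumes "p \<noteq> 0" "x \<noteq> 0"
  shows "theta_term p x (k + 1) = x * p powi k * theta_term p x k"
  using assms triangular_int_Suc[of k]
  by (simp add: theta_term_def power_int_add mult_ac)

lemma theta_term_minus:
  assumes "p \<noteq> 0" "x \<noteq> 0"
  shows "theta_term p x (- k) = theta_term p (p / x) k"
proof -
  have "(- k) * (- k - 1) div 2 = k + k * (k - 1) div 2"
    using triangular_int_Suc[of k] by (simp add: algebra_simps)
  then show ?thesis
    using assms by (simp add: theta_term_def power_int_add power_int_minus power_int_divide_distrib field_simps)
qed

lemma theta_term_of_nat: "theta_term p x (int k) = x ^ k * p ^ (k * (k - 1) div 2)"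
proof -
  have "int k * (int k - 1) div 2 = int (k * (k - 1) div 2)"
    by (cases k) (auto simp: zdiv_int algebra_simps)
  then show ?thesis by (simp add: theta_term_def)
qed

text \<open>Under \<open>k -> - k\<close> the negative half of the series becomes a positive half
  with \<open>p / x\<close> in place of \<open>x\<close>.\<close>

lemma summable_theta_term:
  assumes p: "norm p < 1" "p \<noteq> 0" and x: "x \<noteq> 0"
  shows "(\<lambda>k. norm (theta_term p x k)) summable_on UNIV"
proof -
  have *: "(\<lambda>k. norm (theta_term p y (int k))) summable_on UNIV" for y
    unfolding theta_term_of_nat
    using summable_norm_triangular[OF p(1), of y] by (intro norm_summable_imp_summable_on) simp
  have "(\<lambda>k. norm (theta_term p x k)) summable_on range int"
    by (subst summable_on_reindex) (use *[of x] in \<open>auto simp: o_def\<close>)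
  moreover have "(\<lambda>k. norm (theta_term p x k)) summable_on range (\<lambda>n. - int n)"
    by (subst summable_on_reindex)
       (use *[of "p / x"] theta_term_minus[OF p(2) x] in \<open>auto simp: o_def inj_def\<close>)
  ultimately have "(\<lambda>k. norm (theta_term p x k)) summable_on (range int \<union> range (\<lambda>n. - int n))"
    by (rule summable_on_union)
  also have "range int \<union> range (\<lambda>n. - int n) = UNIV"
  proof -
    have "k \<in> range int \<union> range (\<lambda>n. - int n)" for k
      by (cases k rule: int_cases2) auto
    then show ?thesis by blast
  qed
  finally show ?thesis .
qed

text \<open>Induction on \<open>n\<close>: two Pascal steps give three terms, and shifting the outer
  two by one index multiplies the sum by
  \<open>1 + p ^ (2 * n + 1) + x * p ^ n + p ^ Suc n / x\<close>. This is
  \<open>(1 + x * p ^ n) * (1 + p ^ Suc n / x)\<close>.\<close>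

lemma finite_jacobi_triple_product:
  assumes p: "norm p < 1" "p \<noteq> 0" and x: "x \<noteq> 0"
  shows "(\<Sum>\<^sub>\<infinity>k. theta_term p x k * qbin p (2 * n) (int n + k)) = qpoch (- x) p n * qpoch (- p / x) p n"
proof (induction n)
  case 0
  have "((\<lambda>k. theta_term p x k * qbin p 0 k) has_sum 1) UNIV"
    by (rule has_sum_finite_neutralI[of "{0}"]) (auto simp: qbin_def theta_term_def)
  then show ?case by (simp add: infsumI)
next
  case (Suc n)
  let ?t = "theta_term p x" and ?B = "\<lambda>k. qbin p (2 * n) (int n + k)"
  let ?S = "\<Sum>\<^sub>\<infinity>k. ?t k * ?B k"
  define f where "f k = x * p ^ n * (?t k * ?B k)" for k
  define g where "g k = p ^ Suc n / x * (?t k * ?B k)" for k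
  have sB: "(\<lambda>k. ?t k * ?B k) summable_on UNIV"
    by (rule summable_qbin) (auto simp: inj_def)
  have pascal: "qbin p (2 * Suc n) (int (Suc n) + k)
     = (1 + p ^ (2 * n + 1)) * ?B k + p powi (int n + 1 - k) * ?B (k - 1) + p powi (int n + 1 + k) * ?B (k + 1)" for k
  proof -
    have "p powi (int n + 1 + k) * p powi (int n - k) = p powi (int (2 * n + 1))"
      using p(2) by (simp add: add.commute flip: power_int_add)
    then have "p powi (int n + 1 + k) * p powi (int n - k) = p ^ (2 * n + 1)"
      by (simp only: power_int_of_nat)
    then show ?thesis
      using qbin_Suc'[OF p, of "2 * n + 1" "int n + 1 + k"]
        qbin_Suc[OF p, of "2 * n" "int n + 1 + k"] qbin_Suc[OF p, of "2 * n" "int n + k"]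
      by (simp add: algebra_simps)
  qed
  have "?t k * qbin p (2 * Suc n) (int (Suc n) + k)
      = (1 + p ^ (2 * n + 1)) * (?t k * ?B k) + (f (k + (- 1)) + g (k + 1))" for k
  proof -
    have "p powi (int n + 1 - k) * ?t k = x * p ^ n * ?t (k - 1)"
    proof -
      have "p powi (int n + 1 - k) * p powi (k - 1) = p powi (int n)"
        using p(2) by (simp flip: power_int_add)
      then show ?thesis
        using theta_term_Suc[OF p(2) x, of "k - 1"] by (simp add: mult_ac)
    qed
    moreover have "p powi (int n + 1 + k) * ?t k = p ^ Suc n / x * ?t (k + 1)"
    proof -
      have "p powi (int n + 1 + k) = p powi (int (Suc n)) * p powi k"
        using p(2) by (simp flip: power_int_add add: algebra_simps)
      then show ?thesis
        using theta_term_Suc[OF p(2) x, of k] x by (simp only: power_int_of_nat) simp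
    qed
    ultimately have "?t k * (p powi (int n + 1 - k) * ?B (k - 1)) = f (k - 1)"
      "?t k * (p powi (int n + 1 + k) * ?B (k + 1)) = g (k + 1)"
      unfolding f_def g_def by (metis mult.assoc mult.commute)+
    then show ?thesis
      unfolding pascal by (simp add: algebra_simps)
  qed
  moreover have "(\<lambda>k. f (k + (- 1))) summable_on UNIV" "(\<lambda>k. g (k + 1)) summable_on UNIV"
    unfolding f_def g_def
    by (intro summable_on_cmult_right summable_qbin; simp add: inj_def)+
  ultimately have "(\<Sum>\<^sub>\<infinity>k. ?t k * qbin p (2 * Suc n) (int (Suc n) + k))
      = (1 + p ^ (2 * n + 1)) * ?S + ((\<Sum>\<^sub>\<infinity>k. f (k + (- 1))) + (\<Sum>\<^sub>\<infinity>k. g (k + 1)))"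
    using sB by (simp add: infsum_add summable_on_cmult_right infsum_cmult_right' summable_on_add)
  also have "\<dots> = (1 + p ^ (2 * n + 1)) * ?S + (x * p ^ n * ?S + p ^ Suc n / x * ?S)"
    unfolding infsum_int_shift by (simp only: f_def[abs_def] g_def[abs_def] infsum_cmult_right')
  also have "\<dots> = (1 + x * p ^ n) * (1 + p ^ Suc n / x) * ?S"
    using x by (simp add: field_simps power_add power2_eq_square power_mult)
  finally show ?case
    using Suc by (simp add: mult_ac)
qed

text \<open>Limit of the finite version. Each Gaussian binomial tends to \<open>1 / P\<close> and
  all of them share one bound, so Tannery's theorem applies with a multiple of the norms of the
  theta terms as majorant.\<close>

theorem jacobi_triple_product:
  assumes p: "norm p < 1" "p \<noteq> 0" and x: "x \<noteq> 0"
  shows "theta p x = qpoch_inf p p * qpoch_inf (- x) p * qpoch_inf (- p / x) p"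
proof -
  define P where "P = qpoch_inf p p"
  have P: "P \<noteq> 0" unfolding P_def by (rule qpoch_inf_nonzero[OF p(1) p(1)])
  have lim_nat: "(\<lambda>n. qpoch p p (nat (int n + k))) \<longlonglongrightarrow> P" for k
  proof -
    have "\<exists>N. \<forall>n\<ge>N. Z \<le> nat (int n + k)" for Z
      by (rule exI[of _ "Z + nat \<bar>k\<bar>"]) auto
    then have "filterlim (\<lambda>n. nat (int n + k)) sequentially sequentially"
      unfolding filterlim_at_top eventually_sequentially by blast
    then show ?thesis
      unfolding P_def by (rule filterlim_compose[OF qpoch_tendsto[OF p(1)]])
  qed
  have lim: "(\<lambda>n. qbin p (2 * n) (int n + k)) \<longlonglongrightarrow> 1 / P" for k
  proof -
    have "(\<lambda>n. qpoch p p (2 * n)) \<longlonglongrightarrow> P"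
      unfolding P_def by (rule filterlim_compose[OF qpoch_tendsto[OF p(1)]])
        (simp add: filterlim_subseq strict_mono_def)
    then have "(\<lambda>n. qpoch p p (2 * n) / (qpoch p p (nat (int n + k)) * qpoch p p (nat (int n + (- k)))))
        \<longlonglongrightarrow> P / (P * P)"
      by (intro tendsto_intros lim_nat) (use P in auto)
    \<comment> \<open>Once \<open>n\<close> is at least the absolute value of \<open>k\<close>, the
      index lies in the range where \<open>qbin\<close> is the quotient.\<close>
    moreover have "eventually (\<lambda>n. qpoch p p (2 * n) / (qpoch p p (nat (int n + k)) * qpoch p p (nat (int n + (- k))))
        = qbin p (2 * n) (int n + k)) sequentially"
      unfolding eventually_sequentially by (rule exI[of _ "nat \<bar>k\<bar>"]) (auto simp: qbin_def)
    ultimately show ?thesis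
      using P by (simp add: tendsto_cong)
  qed
  obtain C where C: "C > 0" "\<And>n. norm (qpoch p p n) \<le> C"
    using qpoch_bounded[OF p(1)] by metis
  obtain D where D: "D > 0" "\<And>n. norm (inverse (qpoch p p n)) \<le> D"
    using inverse_qpoch_bounded[OF p(1) p(1)] by metis
  have bound: "norm (qbin p N k) \<le> C * (D * D)" for N k
  proof (cases "0 \<le> k \<and> k \<le> int N")
    case True
    have "norm (qbin p N k) = norm (qpoch p p N) *
        (norm (inverse (qpoch p p (nat k))) * norm (inverse (qpoch p p (nat (int N - k)))))"
      using True by (simp add: qbin_def divide_inverse norm_mult)
    also have "\<dots> \<le> C * (D * D)"
      using C(1) D(1) by (intro mult_mono C(2) D(2)) auto
    finally show ?thesis .
  qed (use C D in \<open>auto simp: qbin_def\<close>)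
  have "(\<lambda>n. \<Sum>\<^sub>\<infinity>k. theta_term p x k * qbin p (2 * n) (int n + k))
      \<longlonglongrightarrow> (\<Sum>\<^sub>\<infinity>k. theta_term p x k * (1 / P))"
  proof (rule tannery_int)
    show "(\<lambda>k. norm (theta_term p x k) * (C * (D * D))) summable_on UNIV"
      by (intro summable_on_cmult_left summable_theta_term p x)
    show "(\<lambda>n. theta_term p x k * qbin p (2 * n) (int n + k)) \<longlonglongrightarrow> theta_term p x k * (1 / P)" for k
      by (intro tendsto_mult_left lim)
  qed (auto intro!: mult_left_mono bound simp: norm_mult)
  moreover have "(\<lambda>n. qpoch (- x) p n * qpoch (- p / x) p n) \<longlonglongrightarrow> qpoch_inf (- x) p * qpoch_inf (- p / x) p"
    by (intro tendsto_intros qpoch_tendsto p)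
  ultimately have "(\<Sum>\<^sub>\<infinity>k. theta_term p x k * (1 / P)) = qpoch_inf (- x) p * qpoch_inf (- p / x) p"
    unfolding finite_jacobi_triple_product[OF p x] by (rule LIMSEQ_unique)
  then have "theta p x / P = qpoch_inf (- x) p * qpoch_inf (- p / x) p"
    by (simp only: infsum_cmult_left' theta_def) simp
  then show ?thesis
    using P by (simp add: P_def field_simps)
qed


section \<open>A Bailey pair and its conjugate\<close>

lemma qpoch_double: "qpoch q q (2 * n) = qpoch q (q\<^sup>2) n * (qpoch q q n * qpoch (- q) q n)"
  using qpoch_dissect[of q q 2 n] qpoch_mult_minus[of q q n]
  by (simp add: lessThan_nat_numeral lessThan_Suc power2_eq_square)

lemma two_triangular_int: "2 * (k * (k - 1) div 2) = k * k - (k :: int)"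
proof -
  have "2 * (k * (k - 1) div 2) = k * (k - 1)"
    by (rule dvd_mult_div_cancel) simp
  then show ?thesis by (simp only: right_diff_distrib mult_1_right)
qed

text \<open>Bailey's sequence \<open>delta_n\<close> for \<open>a = 1\<close>,
  \<open>rho_1 = -1\<close> and \<open>rho_2\<close> tending to infinity.\<close>

definition bailey_weight :: "complex \<Rightarrow> nat \<Rightarrow> complex" where
  "bailey_weight q n = qpoch (- 1) q n * q ^ (n * (n + 1) div 2)"

text \<open>For \<open>-n <= j <= n\<close> this is \<open>1 / ((q;q)_(n-j) (q;q)_(n+j))\<close>,
  the kernel of a Bailey pair relative to \<open>a = 1\<close>; writing it through
  \<open>qbin\<close> makes it vanish for all other \<open>j\<close>.\<close>

definition bailey_kernel :: "complex \<Rightarrow> nat \<Rightarrow> int \<Rightarrow> complex" where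
  "bailey_kernel q n j = qbin q (2 * n) (int n - j) / qpoch q q (2 * n)"

lemma bailey_kernel_minus: "bailey_kernel q n (- j) = bailey_kernel q n j"
  using qbin_sym[of q "2 * n" "int n - j"] by (simp add: bailey_kernel_def)

lemma bailey_kernel_add:
  assumes "norm q < 1"
  shows "bailey_kernel q (k + m) (int m) = inverse (qpoch q q k) * inverse (qpoch q q (2 * m + k))"
proof -
  have "nat (int (2 * (k + m)) - int k) = 2 * m + k" by simp
  then show ?thesis
    using qpoch_nonzero[OF assms assms] by (simp add: bailey_kernel_def qbin_def field_simps)
qed

lemma bailey_pair_slater:
  assumes q: "norm q < 1" "q \<noteq> 0"
  shows "(\<Sum>\<^sub>\<infinity>r. slater_alpha q r * bailey_kernel q n (2 * r)) = 1 / (qpoch q (q\<^sup>2) n * qpoch q q n)"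
proof -
  have "qpoch q q (2 * n) \<noteq> 0" by (rule qpoch_nonzero[OF q(1) q(1)])
  then have nz: "qpoch q (q\<^sup>2) n \<noteq> 0" "qpoch q q n \<noteq> 0" "qpoch (- q) q n \<noteq> 0"
    by (auto simp: qpoch_double)
  have "(\<Sum>\<^sub>\<infinity>r. slater_alpha q r * bailey_kernel q n (2 * r))
      = (\<Sum>\<^sub>\<infinity>r. slater_alpha q r * qbin q (2 * n) (int n - 2 * r) * inverse (qpoch q q (2 * n)))"
    by (simp add: bailey_kernel_def divide_inverse mult_ac)
  also have "\<dots> = qpoch (- q) q n * inverse (qpoch q q (2 * n))"
    by (simp only: infsum_cmult_left' infsum_qbin_slater[OF q])
  finally show ?thesis
    unfolding qpoch_double using nz by (simp add: divide_simps)
qed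

section \<open>The conjugate Bailey pair, from the limiting q-Gauss sum\<close>

lemma triangular_add:
  "(m + k) * (m + k + 1) div 2 = m * (m + 1) div 2 + (m + 1) * k + k * (k - 1) div (2 :: nat)"
proof (induction k)
  case (Suc k)
  then show ?case
    using triangular_Suc[of k] triangular_Suc[of "m + k + 1"] by (simp add: algebra_simps)
qed simp

text \<open>Extending \<open>qpoch (- 1) q m\<close> by one factor and splitting off the first one,
  which is 2, gives \<open>qpoch (- q) q m\<close>.\<close>

lemma bailey_weight_eq:
  assumes q: "norm q < 1"
  shows "bailey_weight q m = 2 * q ^ (m * (m + 1) div 2) / (1 + q ^ m) * qpoch (- q) q m"
    and "1 + q ^ m \<noteq> 0"
proof -
  show nz: "1 + q ^ m \<noteq> 0"
  proof (cases m)
    case (Suc n)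
    then show ?thesis
      using one_minus_geometric_nonzero[OF q, of "- q" n] q by simp
  qed simp
  have "qpoch (- 1) q m * (1 + q ^ m) = 2 * qpoch (- q) q m"
    using qpoch_Suc_shift[of "- 1" q m] by simp
  then have "qpoch (- 1) q m = 2 * qpoch (- q) q m / (1 + q ^ m)"
    using nz by (simp add: field_simps)
  then show "bailey_weight q m = 2 * q ^ (m * (m + 1) div 2) / (1 + q ^ m) * qpoch (- q) q m"
    by (simp add: bailey_weight_def)
qed

text \<open>The terms with \<open>n < m\<close> vanish, and for \<open>n = k + m\<close> the rest is
  a constant multiple of the series in \<open>q_gauss_limit\<close>.\<close>

lemma conjugate_bailey_pair_nat:
  assumes q: "norm q < 1" "q \<noteq> 0"
  shows "(\<lambda>n. bailey_weight q n * bailey_kernel q n (int m)) sums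
    (qpoch_inf (- q) q / qpoch_inf q q * (2 * q ^ (m * (m + 1) div 2) / (1 + q ^ m)))"
proof -
  \<comment> \<open>\<open>c\<close> comes from \<open>(q;q)_(2m+k) = (q;q)_(2m) (c;q)_k\<close>,
    and \<open>d\<close> from \<open>(-1;q)_(m+k)\<close> together with the part
    \<open>(m + 1) * k\<close> of the exponent.\<close>
  define c d where "c = q ^ (2 * m + 1)" and "d = q ^ (m + 1)"
  have c: "norm c < 1"
    unfolding c_def by (rule norm_power_less_1[OF q(1)]) simp
  have nz: "qpoch q q n \<noteq> 0" for n
    by (rule qpoch_nonzero[OF q(1) q(1)])
  have "bailey_weight q (k + m) * bailey_kernel q (k + m) (int m)
      = bailey_weight q m / qpoch q q (2 * m) * gauss_term q c d k" for k
  proof -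
    have "(\<Prod>j<k. d + c * q ^ j) = (\<Prod>j<k. q ^ (m + 1) * (1 - (- 1 * q ^ m) * q ^ j))"
      by (intro prod.cong refl) (simp add: c_def d_def power_add mult_2[of m] distrib_left mult.assoc)
    also have "\<dots> = q ^ ((m + 1) * k) * qpoch (- 1 * q ^ m) q k"
      by (simp only: prod.distrib prod_constant card_lessThan power_mult qpoch_def)
    finally have P: "(\<Prod>j<k. d + c * q ^ j) = q ^ ((m + 1) * k) * qpoch (- 1 * q ^ m) q k" .
    have "bailey_weight q (k + m) = qpoch (- 1) q m * qpoch (- 1 * q ^ m) q k *
        q ^ (m * (m + 1) div 2 + (m + 1) * k + k * (k - 1) div 2)"
      unfolding bailey_weight_def add.commute[of k m] triangular_add qpoch_add ..
    then have w: "bailey_weight q (k + m)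
        = bailey_weight q m * ((\<Prod>j<k. d + c * q ^ j) * q ^ (k * (k - 1) div 2))"
      unfolding P bailey_weight_def by (simp only: power_add mult_ac)
    have "qpoch q q (2 * m + k) = qpoch q q (2 * m) * qpoch c q k"
      by (simp add: qpoch_add c_def)
    then show ?thesis
      unfolding w bailey_kernel_add[OF q(1)] gauss_term_def by (simp add: divide_inverse mult_ac)
  qed
  moreover have "(\<lambda>k. bailey_weight q m / qpoch q q (2 * m) * gauss_term q c d k) sums
      (bailey_weight q m / qpoch q q (2 * m) * (qpoch_inf (- d) q / qpoch_inf c q))"
    by (intro sums_mult q_gauss_limit q c)
  ultimately have "(\<lambda>k. bailey_weight q (k + m) * bailey_kernel q (k + m) (int m)) sums
      (bailey_weight q m / qpoch q q (2 * m) * (qpoch_inf (- d) q / qpoch_inf c q))"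
    by simp
  moreover have "bailey_weight q m / qpoch q q (2 * m) * (qpoch_inf (- d) q / qpoch_inf c q)
      = qpoch_inf (- q) q / qpoch_inf q q * (2 * q ^ (m * (m + 1) div 2) / (1 + q ^ m))"
  proof -
    have "qpoch_inf q q = qpoch q q (2 * m) * qpoch_inf c q"
      using qpoch_inf_split[OF q(1), of q "2 * m"] by (simp add: c_def)
    moreover have "qpoch_inf (- q) q = qpoch (- q) q m * qpoch_inf (- d) q"
      using qpoch_inf_split[OF q(1), of "- q" m] by (simp add: d_def)
    ultimately show ?thesis
      by (simp add: bailey_weight_eq[OF q(1)] mult_ac)
  qed
  moreover have "bailey_weight q n * bailey_kernel q n (int m) = 0" if "n < m" for n
    using that by (simp add: bailey_kernel_def qbin_def)
  ultimately show ?thesis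
    using sums_zero_iff_shift[of m "\<lambda>n. bailey_weight q n * bailey_kernel q n (int m)"] by simp
qed

text \<open>Both sides are even in \<open>j\<close>: the kernel by the symmetry of
  \<open>qbin\<close>, the value on multiplying numerator and denominator by
  \<open>q powi (- j)\<close>.\<close>

lemma conjugate_bailey_pair:
  assumes q: "norm q < 1" "q \<noteq> 0"
  shows "(\<lambda>n. bailey_weight q n * bailey_kernel q n j) sums
    (qpoch_inf (- q) q / qpoch_inf q q * (2 * q powi (j * (j + 1) div 2) / (1 + q powi j)))"
proof (cases j rule: int_cases2)
  case (nonneg m)
  have "int m * (int m + 1) div 2 = int (m * (m + 1) div 2)"
    by (simp add: zdiv_int algebra_simps)
  with nonneg show ?thesis
    using conjugate_bailey_pair_nat[OF q, of m] by simp
next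
  case (nonpos m)
  have "int m + j * (j + 1) div 2 = int (m * (m + 1) div 2)"
    using triangular_int_Suc[of "int m"] nonpos by (simp add: zdiv_int algebra_simps)
  then have "q ^ (m * (m + 1) div 2) = q ^ m * q powi (j * (j + 1) div 2)"
    using q(2) power_int_add[of q "int m" "j * (j + 1) div 2"] by (metis power_int_of_nat)
  moreover have "q powi j = 1 / q ^ m"
    using nonpos by (simp add: power_int_minus_divide)
  moreover have "1 + q ^ m \<noteq> 0"
    by (rule bailey_weight_eq[OF q(1)])
  moreover from this have "1 + 1 / q ^ m = (1 + q ^ m) / q ^ m"
    using q(2) by (simp add: divide_simps add_ac)
  ultimately have "2 * q powi (j * (j + 1) div 2) / (1 + q powi j) = 2 * q ^ (m * (m + 1) div 2) / (1 + q ^ m)"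
    by (simp add: mult_ac)
  then show ?thesis
    using conjugate_bailey_pair_nat[OF q, of m] nonpos by (simp add: bailey_kernel_minus)
qed

section \<open>Bailey's lemma as an interchange of two summations\<close>

lemma one_plus_powi_nonzero:
  fixes q :: complex
  assumes q: "norm q < 1" "q \<noteq> 0"
  shows "1 + q powi j \<noteq> 0"
proof (cases j rule: int_cases2)
  case (nonneg m)
  then show ?thesis using bailey_weight_eq(2)[OF q(1), of m] by simp
next
  case (nonpos m)
  then show ?thesis
    using bailey_weight_eq(2)[OF q(1), of m] q(2)
    by (auto simp: power_int_minus_divide divide_simps add_ac)
qed

text \<open>Uniform in \<open>j\<close> and geometric in \<open>n\<close>, because
  \<open>n <= n * (n + 1) div 2\<close>; with the summability of \<open>slater_alpha\<close> this
  justifies the interchange.\<close>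

lemma bailey_weight_kernel_bound:
  assumes q: "norm q < 1"
  obtains K where "K > 0" "\<And>n j. norm (bailey_weight q n * bailey_kernel q n j) \<le> K * norm q ^ n"
proof -
  obtain C where C: "C > 0" "\<And>n. norm (qpoch (- 1) q n) \<le> C"
    using qpoch_bounded[OF q] by metis
  obtain D where D: "D > 0" "\<And>n. norm (inverse (qpoch q q n)) \<le> D"
    using inverse_qpoch_bounded[OF q q] by metis
  have "norm (bailey_weight q n * bailey_kernel q n j) \<le> C * (D * D) * norm q ^ n" for n j
  proof -
    have "n \<le> n * (n + 1) div 2"
      using mult_le_mono2[of 2 "n + 1" n] by (cases n) auto
    then have "norm q ^ (n * (n + 1) div 2) \<le> norm q ^ n"
      using q by (intro power_decreasing) auto
    then have w: "norm (bailey_weight q n) \<le> C * norm q ^ n"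
      using C by (auto simp: bailey_weight_def norm_mult norm_power intro!: mult_mono)
    have "norm (bailey_kernel q n j) \<le> D * D"
    proof (cases "\<bar>j\<bar> \<le> int n")
      case True
      have "bailey_kernel q n j = inverse (qpoch q q (nat (int n - j))) *
          inverse (qpoch q q (nat (int (2 * n) - (int n - j))))"
        using True qpoch_nonzero[OF q q]
        by (auto simp: bailey_kernel_def qbin_def divide_inverse abs_le_iff)
      then have "norm (bailey_kernel q n j) = norm (inverse (qpoch q q (nat (int n - j)))) *
          norm (inverse (qpoch q q (nat (int (2 * n) - (int n - j)))))"
        by (simp only: norm_mult)
      also have "\<dots> \<le> D * D"
        using D(1) by (intro mult_mono D(2)) auto
      finally show ?thesis .
    qed (use D in \<open>auto simp: bailey_kernel_def qbin_def\<close>)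
    then have "norm (bailey_weight q n * bailey_kernel q n j) \<le> (C * norm q ^ n) * (D * D)"
      unfolding norm_mult by (intro mult_mono w) (use C in auto)
    then show ?thesis by (simp add: mult_ac)
  qed
  then show ?thesis using C(1) D(1) by (intro that[of "C * (D * D)"]) auto
qed

text \<open>In the double sum of \<open>f\<close>, summing over \<open>r\<close> first gives the
  series through the Bailey pair, and summing over \<open>n\<close> first gives its value through
  the conjugate pair.\<close>

lemma sums_slater_mod_10:
  assumes q: "norm q < 1" "q \<noteq> 0"
  shows "(\<lambda>n. bailey_weight q n / (qpoch q (q\<^sup>2) n * qpoch q q n)) sums
    (qpoch_inf (- q) q / qpoch_inf q q * theta (q ^ 10) (- (q ^ 5)))"
proof -
  define f where "f n r = bailey_weight q n * bailey_kernel q n (2 * r) * slater_alpha q r" for n r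
  define c where "c = qpoch_inf (- q) q / qpoch_inf q q"
  have cnz: "c \<noteq> 0"
    unfolding c_def using qpoch_inf_nonzero[OF q(1), of q] qpoch_inf_nonzero[OF q(1), of "- q"] q by simp
  define F where "F r = slater_alpha q r * (2 * q powi (r * (2 * r + 1)) / (1 + q powi (2 * r)))" for r
  obtain K where K: "K > 0" "\<And>n j. norm (bailey_weight q n * bailey_kernel q n j) \<le> K * norm q ^ n"
    using bailey_weight_kernel_bound[OF q(1)] by metis
  have geo: "(\<lambda>n. K * norm q ^ n) summable_on UNIV"
    using q(1) by (intro summable_on_cmult_right norm_summable_imp_summable_on) (simp add: norm_power summable_geometric)
  \<comment> \<open>Recognising \<open>slater_alpha\<close> as a theta term supplies its absolute
    summability.\<close>
  have alpha: "slater_alpha q = theta_term (q ^ 6) (- (q\<^sup>2))"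
  proof
    fix r :: int
    have "2 * r + 6 * (r * (r - 1) div 2) = 3 * r\<^sup>2 - r"
      using two_triangular_int[of r] unfolding power2_eq_square by linarith
    then have "q powi (3 * r\<^sup>2 - r) = q powi (2 * r) * q powi (6 * (r * (r - 1) div 2))"
      using q(2) by (metis power_int_add)
    then show "slater_alpha q r = theta_term (q ^ 6) (- (q\<^sup>2)) r"
      using power_int_mult_distrib[of "-1" "q\<^sup>2" r]
      by (simp add: slater_alpha_def theta_term_def power_int_power)
  qed
  have sa: "(\<lambda>r. norm (slater_alpha q r)) summable_on UNIV"
    unfolding alpha using q by (intro summable_theta_term norm_power_less_1) auto
  have S: "(\<lambda>(n, r). f n r) summable_on (UNIV \<times> UNIV)"
  proof -
    have "(\<lambda>(n, r). complex_of_real (K * norm q ^ n) * complex_of_real (norm (slater_alpha q r))) summable_on (UNIV \<times> UNIV)"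
      using geo sa
      by (intro infsum_mult_Times) (simp_all only: summable_on_of_real)
    then have "(\<lambda>z. norm (case z of (n, r) \<Rightarrow> complex_of_real (K * norm q ^ n) * complex_of_real (norm (slater_alpha q r))))
        summable_on (UNIV \<times> UNIV)"
      by (simp only: flip: summable_on_iff_abs_summable_on_complex)
    then have "(\<lambda>z. norm (case z of (n, r) \<Rightarrow> f n r)) summable_on (UNIV \<times> UNIV)"
    proof (rule Infinite_Sum.abs_summable_on_comparison_test)
      fix z :: "nat \<times> int"
      obtain n r where z: "z = (n, r)" by fastforce
      have "norm (f n r) \<le> K * norm q ^ n * norm (slater_alpha q r)"
        unfolding f_def norm_mult[of _ "slater_alpha q r"] by (intro mult_right_mono K) auto
      then show "norm (case z of (n, r) \<Rightarrow> f n r)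
        \<le> norm (case z of (n, r) \<Rightarrow> complex_of_real (K * norm q ^ n) * complex_of_real (norm (slater_alpha q r)))"
        using K(1) by (simp add: z norm_mult norm_power abs_mult)
    qed
    then show ?thesis by (rule abs_summable_summable)
  qed
  have row: "(\<Sum>\<^sub>\<infinity>r. f n r) = bailey_weight q n / (qpoch q (q\<^sup>2) n * qpoch q q n)" for n
  proof -
    have "(\<Sum>\<^sub>\<infinity>r. f n r) = (\<Sum>\<^sub>\<infinity>r. bailey_weight q n * (slater_alpha q r * bailey_kernel q n (2 * r)))"
      by (simp add: f_def mult_ac)
    then show ?thesis
      by (simp only: infsum_cmult_right' bailey_pair_slater[OF q]) simp
  qed
  have col: "(\<Sum>\<^sub>\<infinity>n. f n r) = c * F r" for r
  proof -
    let ?g = "\<lambda>n. bailey_weight q n * bailey_kernel q n (2 * r)"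
    have "?g summable_on UNIV"
      using Infinite_Sum.abs_summable_on_comparison_test'[OF geo, of ?g] K(2)
      by (intro abs_summable_summable[of ?g]) auto
    then have "infsum ?g UNIV = suminf ?g"
      by (rule infsum_nat_eq_suminf)
    also have "\<dots> = c * (2 * q powi (r * (2 * r + 1)) / (1 + q powi (2 * r)))"
      using sums_unique[OF conjugate_bailey_pair[OF q, of "2 * r"]] by (simp add: c_def)
    finally show ?thesis
      by (simp add: f_def infsum_cmult_left' F_def)
  qed
  have "(\<lambda>(r, n). f n r) summable_on (UNIV \<times> UNIV)"
    using S summable_on_swap[of "\<lambda>(n, r). f n r" UNIV UNIV] by simp
  from summable_on_Sigma_banach[OF this] have "(\<lambda>r. c * F r) summable_on UNIV"
    by (simp add: col)
  then have sF: "F summable_on UNIV"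
    using cnz summable_on_cmult_right'[of c F UNIV] by simp
  have F: "F r = (-1) powi r * q powi (5 * r\<^sup>2) * (2 / (1 + q powi (2 * r)))" for r
  proof -
    have "q powi (3 * r\<^sup>2 - r) * q powi (r * (2 * r + 1)) = q powi (5 * r\<^sup>2)"
      using q(2) by (simp flip: power_int_add) (simp add: power2_eq_square algebra_simps)
    then show ?thesis by (simp add: F_def slater_alpha_def)
  qed
  \<comment> \<open>The weight \<open>2 / (1 + q powi (2 * r))\<close> keeps \<open>F\<close> from
    being a theta term, but the weights at \<open>r\<close> and \<open>- r\<close> add up to
    2.\<close>
  have FF: "F r + F (0 - r) = 2 * theta_term (q ^ 10) (- (q ^ 5)) r" for r
  proof -
    define Q where "Q = q powi (2 * r)"
    have Q: "Q \<noteq> 0" "1 + Q \<noteq> 0"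
      unfolding Q_def using q(2) one_plus_powi_nonzero[OF q] by auto
    have Q': "q powi (- (2 * r)) = 1 / Q"
      by (simp add: Q_def power_int_minus_divide)
    have "1 + 1 / Q = (1 + Q) / Q"
      using Q by (simp add: divide_simps add_ac)
    then have "2 / (1 + Q) + 2 / (1 + 1 / Q) = 2 / (1 + Q) + 2 * Q / (1 + Q)"
      by (simp only: divide_divide_eq_right)
    also have "\<dots> = 2 * (1 + Q) / (1 + Q)"
      by (simp only: distrib_left add_divide_distrib mult_1_right)
    also have "\<dots> = 2"
      by (rule nonzero_mult_div_cancel_right[OF Q(2)])
    finally have "2 / (1 + Q) + 2 / (1 + 1 / Q) = 2" .
    moreover have minus: "(-1 :: complex) powi (- r) = (-1) powi r"
      by (simp add: power_int_minus flip: power_int_inverse)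
    have "F r + F (0 - r) = (-1) powi r * q powi (5 * r\<^sup>2) * (2 / (1 + Q) + 2 / (1 + 1 / Q))"
      unfolding F by (simp add: Q' minus distrib_left flip: Q_def)
    ultimately have "F r + F (0 - r) = 2 * ((-1) powi r * q powi (5 * r\<^sup>2))"
      by simp
    moreover have "theta_term (q ^ 10) (- (q ^ 5)) r = (-1) powi r * q powi (5 * r\<^sup>2)"
    proof -
      have "5 * r + 10 * (r * (r - 1) div 2) = 5 * r\<^sup>2"
        using two_triangular_int[of r] unfolding power2_eq_square by linarith
      then have "q powi (5 * r\<^sup>2) = q powi (5 * r) * q powi (10 * (r * (r - 1) div 2))"
        using q(2) by (metis power_int_add)
      then show ?thesis
        using power_int_mult_distrib[of "-1" "q ^ 5" r]
        by (simp add: theta_term_def power_int_power)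
    qed
    ultimately show ?thesis by simp
  qed
  have "(\<Sum>\<^sub>\<infinity>n. \<Sum>\<^sub>\<infinity>r. f n r) = (\<Sum>\<^sub>\<infinity>r. \<Sum>\<^sub>\<infinity>n. f n r)"
    by (rule infsum_swap_banach[OF S])
  then have "(\<Sum>\<^sub>\<infinity>n. bailey_weight q n / (qpoch q (q\<^sup>2) n * qpoch q q n)) = (\<Sum>\<^sub>\<infinity>r. c * F r)"
    by (simp only: row col)
  also have "\<dots> = c * theta (q ^ 10) (- (q ^ 5))"
  proof -
    have "(\<lambda>r. F (0 - r)) summable_on UNIV"
      using sF by (subst summable_on_reindex_bij_betw[where f = F])
        (rule bij_betwI[of _ _ _ "\<lambda>r. 0 - r"], auto)
    then have "(\<Sum>\<^sub>\<infinity>r. F r + F (0 - r)) = infsum F UNIV + infsum F UNIV"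
      using sF infsum_int_reflect[of F 0] by (simp only: infsum_add)
    then have "2 * theta (q ^ 10) (- (q ^ 5)) = infsum F UNIV + infsum F UNIV"
      unfolding FF theta_def by (simp only: infsum_cmult_right')
    then have "theta (q ^ 10) (- (q ^ 5)) = infsum F UNIV" by simp
    then show ?thesis by (simp only: infsum_cmult_right')
  qed
  finally have eq: "(\<Sum>\<^sub>\<infinity>n. bailey_weight q n / (qpoch q (q\<^sup>2) n * qpoch q q n)) = c * theta (q ^ 10) (- (q ^ 5))" .
  have "(\<lambda>n. bailey_weight q n / (qpoch q (q\<^sup>2) n * qpoch q q n)) summable_on UNIV"
    using summable_on_Sigma_banach[OF S] by (simp add: row)
  from has_sum_imp_sums[OF has_sum_infsum[OF this]] show ?thesis
    unfolding eq by (simp add: c_def)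
qed


section \<open>Theta functions modulo 10\<close>

lemma theta_inversion:
  assumes "p \<noteq> 0" "x \<noteq> 0"
  shows "theta p (p / x) = theta p x"
  using infsum_int_reflect[of "theta_term p x" 0] theta_term_minus[OF assms]
  by (simp add: theta_def)

text \<open>Index pairs with even sum are \<open>(r + s, r - s)\<close>, those with odd sum
  \<open>(r + s + 1, r - s)\<close>. In the new indices the quadratic exponent has no mixed term
  \<open>r * s\<close>, so each part factors.\<close>

lemma theta_mult:
  assumes p: "norm p < 1" "p \<noteq> 0" and x: "x \<noteq> 0" and y: "y \<noteq> 0"
  shows "theta p x * theta p y = theta (p\<^sup>2) (x * y) * theta (p\<^sup>2) (p * x / y)
    + x * theta (p\<^sup>2) (p * x * y) * theta (p\<^sup>2) (p\<^sup>2 * x / y)"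
proof -
  define f where "f = (\<lambda>(m, n). theta_term p x m * theta_term p y n)"
  define g where "g = (\<lambda>(r, s). (r + s, r - s :: int))"
  define h where "h = (\<lambda>(r, s). (r + s + 1, r - s :: int))"
  have sum1: "theta_term b z summable_on UNIV" if "norm b < 1" "b \<noteq> 0" "z \<noteq> 0" for b z
    using summable_theta_term[OF that] by (rule abs_summable_summable)
  have p2: "norm (p\<^sup>2) < 1" "p\<^sup>2 \<noteq> 0"
    using p norm_power_less_1[of p 2] by auto
  have inj: "inj g" "inj h"
    by (auto simp: inj_def g_def h_def)
  have sf: "f summable_on (UNIV \<times> UNIV)"
    and f: "infsum f (UNIV \<times> UNIV) = theta p x * theta p y"
    using infsum_mult_Times[OF sum1[OF p x] sum1[OF p y]] by (simp_all add: f_def theta_def)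
  have disj: "range g \<inter> range h = {}"
  proof -
    have "g u \<noteq> h v" for u v
    proof
      assume "g u = h v"
      then have "2 * fst u = 2 * fst v + 1"
        by (auto simp: g_def h_def split: prod.splits)
      then show False by presburger
    qed
    then show ?thesis by blast
  qed
  have union: "range g \<union> range h = UNIV \<times> UNIV"
  proof -
    have "(m, n) \<in> range g \<union> range h" for m n
    proof (cases "even (m + n)")
      case True
      then obtain r where "m + n = 2 * r" by blast
      then have "(m, n) = g (r, m - r)" by (simp add: g_def)
      then show ?thesis by blast
    next
      case False
      then obtain r where "m + n = 2 * r + 1" by (blast elim: oddE)
      then have "(m, n) = h (r, m - 1 - r)" by (simp add: h_def)
      then show ?thesis by blast
    qed
    then show ?thesis by auto
  qed
  have gterm: "f (g (r, s)) = theta_term (p\<^sup>2) (x * y) r * theta_term (p\<^sup>2) (p * x / y) s" for r s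
  proof -
    have "(r + s) * (r + s - 1) div 2 + (r - s) * (r - s - 1) div 2
        = 2 * (r * (r - 1) div 2) + (s + 2 * (s * (s - 1) div 2))"
    proof -
      \<comment> \<open>Doubling clears the integer divisions.\<close>
      have "2 * ((r + s) * (r + s - 1) div 2 + (r - s) * (r - s - 1) div 2)
          = 2 * (2 * (r * (r - 1) div 2) + (s + 2 * (s * (s - 1) div 2)))"
        unfolding distrib_left two_triangular_int by (simp add: algebra_simps)
      then show ?thesis by (simp only: mult_cancel_left) simp
    qed
    then have p_eq: "p powi ((r + s) * (r + s - 1) div 2) * p powi ((r - s) * (r - s - 1) div 2)
        = p powi (2 * (r * (r - 1) div 2)) * (p powi s * p powi (2 * (s * (s - 1) div 2)))"
      using p(2) by (simp flip: power_int_add)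
    have xy_eq: "x powi (r + s) * y powi (r - s) = (x * y) powi r * (x / y) powi s"
      using x y by (simp add: power_int_add power_int_diff power_int_mult_distrib power_int_divide_distrib)
    have "f (g (r, s)) = (x powi (r + s) * y powi (r - s)) *
        (p powi ((r + s) * (r + s - 1) div 2) * p powi ((r - s) * (r - s - 1) div 2))"
      by (simp add: f_def g_def theta_term_def mult_ac)
    also have "\<dots> = theta_term (p\<^sup>2) (x * y) r * theta_term (p\<^sup>2) (p * x / y) s"
      unfolding p_eq xy_eq
      by (simp add: theta_term_def power_int_power power_int_mult_distrib power_int_divide_distrib mult_ac)
    finally show ?thesis .
  qed
  have hterm: "f (h (r, s)) = x * (theta_term (p\<^sup>2) (p * x * y) r * theta_term (p\<^sup>2) (p\<^sup>2 * x / y) s)" for r s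
  proof -
    have "(r + s + 1) * (r + s) div 2 + (r - s) * (r - s - 1) div 2
        = (r + 2 * (r * (r - 1) div 2)) + (2 * s + 2 * (s * (s - 1) div 2))"
    proof -
      have "2 * ((r + s + 1) * (r + s) div 2 + (r - s) * (r - s - 1) div 2)
          = 2 * ((r + 2 * (r * (r - 1) div 2)) + (2 * s + 2 * (s * (s - 1) div 2)))"
        unfolding distrib_left two_triangular_int
        using two_triangular_int[of "r + s + 1"] by (simp add: algebra_simps)
      then show ?thesis by (simp only: mult_cancel_left) simp
    qed
    then have p_eq: "p powi ((r + s + 1) * (r + s) div 2) * p powi ((r - s) * (r - s - 1) div 2)
        = (p powi r * p powi (2 * (r * (r - 1) div 2))) * (p powi (2 * s) * p powi (2 * (s * (s - 1) div 2)))"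
      using p(2) by (simp flip: power_int_add)
    have xy_eq: "x powi (r + s + 1) * y powi (r - s) = x * ((x * y) powi r * (x / y) powi s)"
      using x y by (simp add: power_int_add power_int_diff power_int_mult_distrib power_int_divide_distrib)
    have "f (h (r, s)) = (x powi (r + s + 1) * y powi (r - s)) *
        (p powi ((r + s + 1) * (r + s) div 2) * p powi ((r - s) * (r - s - 1) div 2))"
      by (simp add: f_def h_def theta_term_def mult_ac)
    also have "\<dots> = x * (theta_term (p\<^sup>2) (p * x * y) r * theta_term (p\<^sup>2) (p\<^sup>2 * x / y) s)"
      unfolding p_eq xy_eq
      by (simp add: theta_term_def power_int_power power_int_mult_distrib power_int_divide_distrib mult_ac)
    finally show ?thesis .
  qed
  have "infsum f (UNIV \<times> UNIV) = infsum f (range g) + infsum f (range h)"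
    unfolding union[symmetric]
    by (intro infsum_Un_disjoint disj summable_on_subset_banach[OF sf]) auto
  also have "infsum f (range g) = theta (p\<^sup>2) (x * y) * theta (p\<^sup>2) (p * x / y)"
  proof -
    have "infsum f (range g) = (\<Sum>\<^sub>\<infinity>(r, s)\<in>UNIV \<times> UNIV.
        theta_term (p\<^sup>2) (x * y) r * theta_term (p\<^sup>2) (p * x / y) s)"
      unfolding infsum_reindex[OF inj(1)] by (intro infsum_cong_neutral) (auto simp: gterm)
    then show ?thesis
      using p p2 x y by (simp only: infsum_mult_Times(2) sum1 theta_def divide_eq_0_iff mult_eq_0_iff simp_thms)
  qed
  also have "infsum f (range h) = x * (theta (p\<^sup>2) (p * x * y) * theta (p\<^sup>2) (p\<^sup>2 * x / y))"
  proof -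
    have "infsum f (range h) = (\<Sum>\<^sub>\<infinity>z\<in>UNIV \<times> UNIV. x * (case z of (r, s) \<Rightarrow>
        theta_term (p\<^sup>2) (p * x * y) r * theta_term (p\<^sup>2) (p\<^sup>2 * x / y) s))"
      unfolding infsum_reindex[OF inj(2)] by (intro infsum_cong_neutral) (auto simp: hterm)
    then show ?thesis
      using p p2 x y
      by (simp only: infsum_cmult_right' infsum_mult_Times(2) sum1 theta_def divide_eq_0_iff mult_eq_0_iff simp_thms)
  qed
  finally show ?thesis
    unfolding f by (simp only: mult.assoc)
qed

text \<open>If the first two pair products split as \<open>u + v\<close> and \<open>u' + v'\<close>,
  then changing the sign of all arguments gives \<open>u - v\<close> and \<open>u' - v'\<close>, so
  the left side is \<open>2 * (u * v' + v * u')\<close>. From this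
  \<open>2 * q * (T 5 * T 5)\<close> comes out, and the cofactor is the splitting of
  \<open>J q * J (q ^ 2)\<close>.\<close>

lemma theta_quartic_mod_10:
  assumes q: "norm q < 1" "q \<noteq> 0"
  defines "J \<equiv> theta (q ^ 10)"
  shows "J q * J (q ^ 4) * (J (q ^ 2) * J (q ^ 3)) - J (- q) * J (- (q ^ 4)) * (J (- (q ^ 2)) * J (- (q ^ 3)))
    = q * (J 1 * J (q ^ 5)) * (J q * J (q ^ 2))"
proof -
  define T where "T i = theta (q ^ 20) (q ^ i)" for i
  have p: "norm (q ^ 10) < 1" "q ^ 10 \<noteq> 0"
    using q norm_power_less_1[of q 10] by auto
  have inv: "T (20 - i) = T i" if "i \<le> 20" for i
    using theta_inversion[of "q ^ 20" "q ^ i"] q that by (simp add: T_def power_diff)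
  have T: "T 15 = T 5" "T 17 = T 3" "T 19 = T 1" "T 13 = T 7"
    using inv[of 5] inv[of 3] inv[of 1] inv[of 7] by simp_all
  \<comment> \<open>Since \<open>s * s = 1\<close>, only the second term keeps the sign;
    \<open>j <= 10\<close> makes the subtractions of naturals exact.\<close>
  have mult: "J (s * q ^ i) * J (s * q ^ j)
      = T (i + j) * T (10 + i - j) + s * q ^ i * T (10 + i + j) * T (20 + i - j)"
    if "s = 1 \<or> s = - 1" "j \<le> 10" for s i j
  proof -
    have "J (s * q ^ i) * J (s * q ^ j)
      = theta (q ^ 20) (s * q ^ i * (s * q ^ j)) * theta (q ^ 20) (q ^ 10 * (s * q ^ i) / (s * q ^ j))
      + s * q ^ i * theta (q ^ 20) (q ^ 10 * (s * q ^ i) * (s * q ^ j)) * theta (q ^ 20) (q ^ 20 * (s * q ^ i) / (s * q ^ j))"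
      using theta_mult[OF p, of "s * q ^ i" "s * q ^ j"] q that by (auto simp: J_def simp flip: power_mult)
    then show ?thesis
      using q that by (auto simp: T_def power_diff power_add)
  qed
  \<comment> \<open>Here \<open>j = 4\<close> and \<open>i = 1\<close>; inversion turns
    \<open>T 15\<close> and \<open>T 17\<close> into \<open>T 5\<close> and \<open>T 3\<close>, and
    similarly below.\<close>
  have 1: "J q * J (q ^ 4) = T 5 * T 7 + q * T 5 * T 3"
    using mult[of 1 4 1] by (simp add: T)
  have 2: "J (- q) * J (- (q ^ 4)) = T 5 * T 7 - q * T 5 * T 3"
    using mult[of "-1" 4 1] by (simp add: T)
  have 3: "J (q ^ 2) * J (q ^ 3) = T 5 * T 9 + q ^ 2 * T 5 * T 1"
    using mult[of 1 3 2] by (simp add: T)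
  have 4: "J (- (q ^ 2)) * J (- (q ^ 3)) = T 5 * T 9 - q ^ 2 * T 5 * T 1"
    using mult[of "-1" 3 2] by (simp add: T)
  have 5: "J 1 * J (q ^ 5) = 2 * (T 5 * T 5)"
    using mult[of 1 5 0] by (simp add: T)
  have 6: "J q * J (q ^ 2) = T 3 * T 9 + q * T 7 * T 1"
    using mult[of 1 2 1] by (simp add: T numeral_3_eq_3)
  show ?thesis
    unfolding 1 2 3 4 5 6 by (simp add: algebra_simps power2_eq_square)
qed

text \<open>The quartic relation with every theta function replaced by its triple product; both
  sides carry \<open>a 10 ^ 4\<close>, which cancels.\<close>

lemma qpoch_inf_mod_10:
  assumes q: "norm q < 1" "q \<noteq> 0"
  defines "a \<equiv> \<lambda>i::nat. qpoch_inf (q ^ i) (q ^ 10)" and "b \<equiv> \<lambda>i::nat. qpoch_inf (- (q ^ i)) (q ^ 10)"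
  shows "b 1 * b 2 * b 8 * b 9 * (b 3 * b 4 * b 6 * b 7) - a 1 * a 2 * a 3 * a 4 * a 6 * a 7 * a 8 * a 9
    = 2 * q * (b 10)\<^sup>2 * (b 5)\<^sup>2 * (b 1 * b 2 * b 8 * b 9)"
proof -
  have p: "norm (q ^ 10) < 1" "q ^ 10 \<noteq> 0"
    using q norm_power_less_1[of q 10] by auto
  have P: "a 10 \<noteq> 0"
    unfolding a_def by (rule qpoch_inf_nonzero[OF p(1) p(1)])
  have plus: "theta (q ^ 10) (q ^ i) = a 10 * (b i * b (10 - i))" if "i \<le> 10" for i
    using jacobi_triple_product[OF p, of "q ^ i"] q that by (simp add: a_def b_def power_diff)
  have minus: "theta (q ^ 10) (- (q ^ i)) = a 10 * (a i * a (10 - i))" if "i \<le> 10" for i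
    using jacobi_triple_product[OF p, of "- (q ^ i)"] q that by (simp add: a_def power_diff)
  \<comment> \<open>\<open>J 1\<close> produces \<open>b 0\<close>, whose first factor is 2 and
    whose remaining factors form \<open>b 10\<close>.\<close>
  have b0: "b 0 = 2 * b 10"
    using qpoch_inf_split[OF p(1), of "- 1" 1] by (simp add: b_def)
  have "a 10 ^ 4 * (b 1 * b 2 * b 8 * b 9 * (b 3 * b 4 * b 6 * b 7) - a 1 * a 2 * a 3 * a 4 * a 6 * a 7 * a 8 * a 9)
    = a 10 ^ 4 * (2 * q * (b 10)\<^sup>2 * (b 5)\<^sup>2 * (b 1 * b 2 * b 8 * b 9))"
    using theta_quartic_mod_10[OF q] plus[of 0] plus[of 1] plus[of 2] plus[of 3] plus[of 4] plus[of 5]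
      minus[of 1] minus[of 2] minus[of 3] minus[of 4] b0
    by (simp add: algebra_simps power2_eq_square power4_eq_xxxx)
  then show ?thesis
    using P by simp
qed

text \<open>Splitting the products into residues modulo 10 reduces the claim to
  \<open>qpoch_inf_mod_10\<close>, with Euler's theorem used in base \<open>q\<close> and in base
  \<open>q ^ 5\<close>.\<close>

lemma slater_product_mod_10:
  assumes q: "norm q < 1" "q \<noteq> 0"
  shows "qpoch_inf (- q) q / qpoch_inf q q * theta (q ^ 10) (- (q ^ 5)) - 1
    = 2 * q * (qpoch_inf (q ^ 10) (q ^ 10) / (qpoch_inf q q * qpoch_inf q (q\<^sup>2) *
        qpoch_inf_list [- (q ^ 3), - (q ^ 4), - (q ^ 6), - (q ^ 7)] (q ^ 10)))"
proof -
  define a b where "a i = qpoch_inf (q ^ i) (q ^ 10)" and "b i = qpoch_inf (- (q ^ i)) (q ^ 10)" for i :: nat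
  \<comment> \<open>\<open>B\<close> takes the residues plus or minus 1 and 2 modulo 10,
    \<open>R\<close> those plus or minus 3 and 4, which form the denominator of the claim.\<close>
  define A B R where "A = a 1 * a 2 * a 3 * a 4 * a 6 * a 7 * a 8 * a 9"
    and "B = b 1 * b 2 * b 8 * b 9" and "R = b 3 * b 4 * b 6 * b 7"
  define D N E where "D = qpoch_inf q q" and "N = qpoch_inf (- q) q" and "E = qpoch_inf q (q\<^sup>2)"
  have p: "norm (q ^ 10) < 1" "q ^ 10 \<noteq> 0"
    using q norm_power_less_1[of q 10] by auto
  have b: "b i \<noteq> 0" if "i > 0" for i
    unfolding b_def using that q norm_power_less_1[of q i] by (intro qpoch_inf_nonzero p) auto
  have "D = (\<Prod>i<10. a (Suc i))" "N = (\<Prod>i<10. b (Suc i))"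
    using qpoch_inf_dissect[OF q(1), of 10 q] qpoch_inf_dissect[OF q(1), of 10 "- q"]
    by (simp_all add: D_def N_def a_def b_def)
  then have D: "D = A * a 5 * a 10" and N: "N = B * R * b 5 * b 10"
    by (simp_all add: A_def B_def R_def lessThan_nat_numeral lessThan_Suc mult_ac eval_nat_numeral)
  have E: "E * N = 1"
    unfolding E_def N_def by (rule euler_odd_distinct[OF q(1)])
  have e5: "a 5 * (b 5 * b 10) = 1"
  proof -
    have q5: "norm (q ^ 5) < 1" using q norm_power_less_1[of q 5] by simp
    have "qpoch_inf (- (q ^ 5)) (q ^ 5) = b 5 * b 10"
      using qpoch_inf_dissect[OF q5, of 2 "- (q ^ 5)"]
      by (simp add: b_def lessThan_nat_numeral lessThan_Suc mult_ac flip: power_mult power_add)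
    then show ?thesis
      using euler_odd_distinct[OF q5] by (simp add: a_def flip: power_mult)
  qed
  have th: "theta (q ^ 10) (- (q ^ 5)) = a 10 * (a 5)\<^sup>2"
    using jacobi_triple_product[OF p, of "- (q ^ 5)"] q
    by (simp add: a_def power2_eq_square power_diff[of q 5 10, symmetric])
  have key: "B * R - A = 2 * q * (b 10)\<^sup>2 * (b 5)\<^sup>2 * B"
    using qpoch_inf_mod_10[OF q] by (simp add: A_def B_def R_def a_def b_def)
  have nz: "D \<noteq> 0" "R \<noteq> 0" "E \<noteq> 0"
    using b E qpoch_inf_nonzero[OF q(1) q(1)] by (auto simp: D_def R_def)
  have "N * (a 10 * (a 5)\<^sup>2) * R - D * R = 2 * q * a 10 * N"
  proof -
    \<comment> \<open>The relation \<open>e5\<close> is used twice: to bring the bracket to the form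
      \<open>B * R - A\<close>, and to remove what is left beside \<open>N\<close>.\<close>
    have "N * (a 10 * (a 5)\<^sup>2) * R - D * R = a 10 * R * a 5 * (B * R * (a 5 * (b 5 * b 10)) - A)"
      unfolding D N by (simp add: algebra_simps power2_eq_square)
    also have "\<dots> = a 10 * R * a 5 * (2 * q * (b 10)\<^sup>2 * (b 5)\<^sup>2 * B)"
      unfolding e5 using key by simp
    also have "\<dots> = 2 * q * a 10 * N * (a 5 * (b 5 * b 10))"
      unfolding N by (simp add: algebra_simps power2_eq_square)
    finally show ?thesis by (simp add: e5)
  qed
  then have "N / D * (a 10 * (a 5)\<^sup>2) - 1 = 2 * q * a 10 * N / (D * R)"
    using nz by (simp add: field_simps)
  also have "\<dots> = 2 * q * (a 10 / (D * E * R))"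
    using nz E by (simp add: field_simps)
  finally show ?thesis
    unfolding th D_def N_def E_def R_def a_def b_def by (simp add: qpoch_inf_list_def mult_ac)
qed

section \<open>Return from \<open>S\<close> to the left-hand side by the shift of index\<close>

theorem theorem2p6:
  fixes q :: complex
  assumes "norm q < 1"
  shows "(\<lambda>n. q ^ ((n\<^sup>2 + 3 * n) div 2) * qpoch (- q) q n /
              (qpoch q (q\<^sup>2) (n + 1) * qpoch q q (n + 1)))
         sums
         (qpoch_inf (q ^ 10) (q ^ 10) /
           (qpoch_inf q q * qpoch_inf q (q\<^sup>2) *
            qpoch_inf_list [- (q ^ 3), - (q ^ 4), - (q ^ 6), - (q ^ 7)] (q ^ 10)))"
    (is "?f sums ?rhs")
proof (cases "q = 0")
  \<comment> \<open>The bilateral sums involve negative powers of \<open>q\<close>, and the last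
    step divides by \<open>2 * q\<close>. At \<open>q = 0\<close> only the term \<open>n = 0\<close>
    survives.\<close>
  case True
  have "?f n = 0" if "n \<noteq> 0" for n
  proof -
    have "(n\<^sup>2 + 3 * n) div 2 \<noteq> 0"
      using that by (cases n) (auto simp: power2_eq_square)
    then show ?thesis using True by simp
  qed
  then have "?f sums (\<Sum>n\<in>{0}. ?f n)"
    by (intro sums_finite) auto
  then show ?thesis
    using True by (simp add: qpoch_inf_def qpoch_inf_list_def)
next
  case False
  \<comment> \<open>The summand of \<open>S\<close>: its shifted terms are \<open>2 * q\<close>
    times those of the left-hand side, and \<open>g 0 = 1\<close> accounts for the constant.\<close>
  define g where "g n = bailey_weight q n / (qpoch q (q\<^sup>2) n * qpoch q q n)" for n
  have g: "g (Suc n) = 2 * q * ?f n" for n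
  proof -
    have "Suc n * (Suc n + 1) = (n\<^sup>2 + 3 * n) + 2"
      by (simp add: power2_eq_square)
    then have "Suc n * (Suc n + 1) div 2 = Suc ((n\<^sup>2 + 3 * n) div 2)"
      by simp
    moreover have "qpoch (- 1) q (Suc n) = 2 * qpoch (- q) q n"
      using qpoch_Suc_shift[of "- 1" q n] by simp
    ultimately have "bailey_weight q (Suc n) = 2 * q * (q ^ ((n\<^sup>2 + 3 * n) div 2) * qpoch (- q) q n)"
      unfolding bailey_weight_def by simp
    then show ?thesis by (simp add: g_def)
  qed
  have "g sums (2 * q * ?rhs + g 0)"
    using sums_slater_mod_10[OF assms False] slater_product_mod_10[OF assms False]
    by (simp add: g_def[abs_def] bailey_weight_def algebra_simps)
  then have "(\<lambda>n. 2 * q * ?f n) sums (2 * q * ?rhs)"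
    unfolding g[symmetric] by (subst sums_Suc_iff) simp
  then show ?thesis
    using False sums_mult_iff[of "2 * q" ?f ?rhs] by simp
qed

end
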